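(* Let $d\ge1$, let $\mathcal{H}^+=-\frac{1}{4\pi}\Delta+\pi|x|^2$ on $\mathbb{R}^d$ and $\mathcal{I}=(-\pi/4,\pi/4)$. There exists $V\in L^\infty_c(\mathcal{I}\times\mathbb{R}^d)$ such that $$\operatorname{Tr}\left(\int_{\mathcal{I}}e^{-it\mathcal{H}^+}V(t,x)e^{it\mathcal{H}^+}\,dt\right)^{d+1}=+\infty.$$
   Context: $L^\infty_c(\mathcal{I}\times\mathbb{R}^d)$ denotes the bounded measurable functions on $\mathcal{I}\times\mathbb{R}^d$ with compact support. For each $t$, $V(t,x)$ is identified with the operator of multiplication by $V(t,\cdot)$ on $L^2(\mathbb{R}^d)$, and $e^{it\mathcal{H}^+}$ is the unitary group on $L^2(\mathbb{R}^d)$ generated by the self-adjoint operator $\mathcal{H}^+$. The exponent $d+1$ is applied to the operator, i.e. the quantity is the trace of the $(d+1)$-th power. *)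

theory Defs
  imports "HOL-Analysis.Analysis"
begin

section \<open>The Hilbert space of square-integrable functions\<close>

definition square_integrable :: "('a::euclidean_space \<Rightarrow> complex) \<Rightarrow> bool" where
  "square_integrable f \<longleftrightarrow>
     f \<in> borel_measurable lborel \<and> integrable lborel (\<lambda>x. (cmod (f x))\<^sup>2)"

lemma square_integrable_zero: "square_integrable (\<lambda>x. 0)"
  by (simp add: square_integrable_def)

lemma square_integrable_cmult:
  assumes "square_integrable f"
  shows "square_integrable (\<lambda>x. c * f x)"
  using assms unfolding square_integrable_def
  by (auto simp: norm_mult power_mult_distrib)

lemma square_integrable_add:
  assumes "square_integrable f" "square_integrable g"
  shows "square_integrable (\<lambda>x. f x + g x)"
proof -
  have [measurable]: "f \<in> borel_measurable lborel" "g \<in> borel_measurable lborel"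
    using assms by (auto simp: square_integrable_def)
  have "integrable lborel (\<lambda>x. 2 * (cmod (f x))\<^sup>2 + 2 * (cmod (g x))\<^sup>2)"
    using assms by (auto simp: square_integrable_def)
  then have "integrable lborel (\<lambda>x. (cmod (f x + g x))\<^sup>2)"
  proof (rule Bochner_Integration.integrable_bound)
    show "AE x in lborel. norm ((cmod (f x + g x))\<^sup>2)
            \<le> norm (2 * (cmod (f x))\<^sup>2 + 2 * (cmod (g x))\<^sup>2)"
    proof (rule AE_I2)
      fix x
      have "(cmod (f x + g x))\<^sup>2 \<le> (cmod (f x) + cmod (g x))\<^sup>2"
        by (intro power_mono norm_triangle_ineq) auto
      also have "\<dots> \<le> 2 * (cmod (f x))\<^sup>2 + 2 * (cmod (g x))\<^sup>2"
        using sum_squares_bound[of "cmod (f x)" "cmod (g x)"] by (simp add: power2_sum)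
      finally show "norm ((cmod (f x + g x))\<^sup>2)
            \<le> norm (2 * (cmod (f x))\<^sup>2 + 2 * (cmod (g x))\<^sup>2)" by simp
    qed
  qed measurable
  then show ?thesis by (simp add: square_integrable_def)
qed

lemma square_integrable_integrable_mult:
  assumes "square_integrable f" "square_integrable g"
  shows "integrable lborel (\<lambda>x. cnj (f x) * g x)"
proof -
  have [measurable]: "f \<in> borel_measurable lborel" "g \<in> borel_measurable lborel"
    using assms by (auto simp: square_integrable_def)
  have [measurable]: "(\<lambda>x. cnj (f x)) \<in> borel_measurable lborel"
    by (intro borel_measurable_continuous_on[of cnj] continuous_intros) auto
  have "integrable lborel (\<lambda>x. (cmod (f x))\<^sup>2 + (cmod (g x))\<^sup>2)"
    using assms by (auto simp: square_integrable_def)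
  then show ?thesis
  proof (rule Bochner_Integration.integrable_bound)
    show "AE x in lborel. norm (cnj (f x) * g x) \<le> norm ((cmod (f x))\<^sup>2 + (cmod (g x))\<^sup>2)"
    proof (rule AE_I2)
      fix x
      have "0 \<le> cmod (f x) * cmod (g x)" by simp
      then have "cmod (f x) * cmod (g x) \<le> (cmod (f x))\<^sup>2 + (cmod (g x))\<^sup>2"
        using sum_squares_bound[of "cmod (f x)" "cmod (g x)"] unfolding mult.assoc by linarith
      then show "norm (cnj (f x) * g x) \<le> norm ((cmod (f x))\<^sup>2 + (cmod (g x))\<^sup>2)"
        by (simp add: norm_mult)
    qed
  qed measurable
qed

definition L2_rel :: "('a::euclidean_space \<Rightarrow> complex) \<Rightarrow> ('a \<Rightarrow> complex) \<Rightarrow> bool" where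
  "L2_rel f g \<longleftrightarrow> square_integrable f \<and> square_integrable g \<and> (AE x in lborel. f x = g x)"

lemma part_equivp_L2_rel:
  "part_equivp (L2_rel :: ('a::euclidean_space \<Rightarrow> complex) \<Rightarrow> _)"
proof (rule part_equivpI)
  show "\<exists>f. L2_rel f f"
    by (rule exI[of _ "\<lambda>x. 0"]) (simp add: L2_rel_def square_integrable_zero)
  show "symp L2_rel"
    by (rule sympI) (auto simp: L2_rel_def)
  show "transp (L2_rel :: ('a \<Rightarrow> complex) \<Rightarrow> _)"
  proof (rule transpI)
    fix f g h :: "'a \<Rightarrow> complex"
    assume "L2_rel f g" "L2_rel g h"
    moreover from this have "AE x in lborel. f x = g x" "AE x in lborel. g x = h x"
      by (auto simp: L2_rel_def)
    then have "AE x in lborel. f x = h x" by eventually_elim simp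
    ultimately show "L2_rel f h" by (auto simp: L2_rel_def)
  qed
qed

quotient_type (overloaded) 'a L2 = "'a::euclidean_space \<Rightarrow> complex" / partial: L2_rel
  by (rule part_equivp_L2_rel)

text \<open>The inner product is linear in its second argument.\<close>

lift_definition cinner :: "'a::euclidean_space L2 \<Rightarrow> 'a L2 \<Rightarrow> complex" is
  "\<lambda>f g. LINT x|lborel. cnj (f x) * g x"
proof -
  fix f f' g g' :: "'a \<Rightarrow> complex"
  assume f: "L2_rel f f'" and g: "L2_rel g g'"
  have "integrable lborel (\<lambda>x. cnj (f x) * g x)" "integrable lborel (\<lambda>x. cnj (f' x) * g' x)"
    using f g by (auto simp: L2_rel_def intro: square_integrable_integrable_mult)
  moreover have "AE x in lborel. cnj (f x) * g x = cnj (f' x) * g' x"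
  proof -
    have "AE x in lborel. f x = f' x" "AE x in lborel. g x = g' x"
      using f g by (auto simp: L2_rel_def)
    then show ?thesis by eventually_elim simp
  qed
  ultimately show "(LINT x|lborel. cnj (f x) * g x) = (LINT x|lborel. cnj (f' x) * g' x)"
    by (intro integral_cong_AE) (auto dest: borel_measurable_integrable)
qed

lift_definition scaleC :: "complex \<Rightarrow> 'a::euclidean_space L2 \<Rightarrow> 'a L2" is
  "\<lambda>c f x. c * f x"
  by (auto simp: L2_rel_def intro: square_integrable_cmult)

instantiation L2 :: (euclidean_space) ab_group_add
begin

lift_definition zero_L2 :: "'a L2" is "\<lambda>x. 0"
  by (simp add: L2_rel_def square_integrable_zero)

lift_definition plus_L2 :: "'a L2 \<Rightarrow> 'a L2 \<Rightarrow> 'a L2" is "\<lambda>f g x. f x + g x"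
  by (auto simp: L2_rel_def intro: square_integrable_add)

definition uminus_L2 :: "'a L2 \<Rightarrow> 'a L2" where "- f = scaleC (-1) f"

definition minus_L2 :: "'a L2 \<Rightarrow> 'a L2 \<Rightarrow> 'a L2" where "f - g = f + - (g :: 'a L2)"

instance
proof
  fix a b c :: "'a L2"
  show "a + b + c = a + (b + c)"
    by transfer (auto simp: L2_rel_def add.assoc intro!: square_integrable_add)
  show "a + b = b + a"
    by transfer (auto simp: L2_rel_def add.commute intro!: square_integrable_add)
  show "0 + a = a"
    by transfer (auto simp: L2_rel_def)
  show "- a + a = 0"
    unfolding uminus_L2_def
    by transfer (auto simp: L2_rel_def square_integrable_zero)
  show "a - b = a + - b" by (rule minus_L2_def)
qed

end

lemma cinner_add_right: "cinner f (g + h) = cinner f g + cinner f h"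
  by transfer (auto simp: L2_rel_def distrib_left square_integrable_integrable_mult
      intro!: Bochner_Integration.integral_add)

lemma cinner_scaleC_right: "cinner f (scaleC c g) = c * cinner f g"
  by transfer (simp add: mult.left_commute)

lemma cinner_commute: "cinner g f = cnj (cinner f g)"
proof transfer
  fix f g :: "'a \<Rightarrow> complex"
  have "cnj (LINT x|lborel. cnj (f x) * g x) = (LINT x|lborel. cnj (cnj (f x) * g x))"
    by (rule Bochner_Integration.integral_cnj[symmetric])
  then show "(LINT x|lborel. cnj (g x) * f x) = cnj (LINT x|lborel. cnj (f x) * g x)"
    by (simp add: mult.commute)
qed

lemma Re_cinner_self_nonneg: "0 \<le> Re (cinner f f)"
proof transfer
  fix f :: "'a \<Rightarrow> complex"
  assume "L2_rel f f"
  then have "integrable lborel (\<lambda>x. cnj (f x) * f x)"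
    by (auto simp: L2_rel_def intro: square_integrable_integrable_mult)
  then have "Re (LINT x|lborel. cnj (f x) * f x) = (LINT x|lborel. Re (cnj (f x) * f x))"
    by (rule integral_Re[symmetric])
  also have "0 \<le> \<dots>" by (intro Bochner_Integration.integral_nonneg) simp
  finally show "0 \<le> Re (LINT x|lborel. cnj (f x) * f x)" .
qed

lemma Re_cinner_self_eq_0: "Re (cinner f f) = 0 \<longleftrightarrow> f = 0"
proof transfer
  fix f :: "'a \<Rightarrow> complex"
  assume f: "L2_rel f f"
  then have int: "integrable lborel (\<lambda>x. cnj (f x) * f x)"
    by (auto simp: L2_rel_def intro: square_integrable_integrable_mult)
  then have "Re (LINT x|lborel. cnj (f x) * f x) = (LINT x|lborel. Re (cnj (f x) * f x))"
    by (rule integral_Re[symmetric])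
  moreover have "(LINT x|lborel. Re (cnj (f x) * f x)) = 0
      \<longleftrightarrow> (AE x in lborel. Re (cnj (f x) * f x) = 0)"
    using integrable_Re[OF int] by (intro integral_nonneg_eq_0_iff_AE) auto
  moreover have "Re (cnj (f x) * f x) = 0 \<longleftrightarrow> f x = 0" for x
    by (auto simp: complex_eq_iff)
  ultimately show "Re (LINT x|lborel. cnj (f x) * f x) = 0 \<longleftrightarrow> L2_rel f (\<lambda>x. 0)"
    using f unfolding L2_rel_def by (simp only: square_integrable_zero simp_thms)
qed

instantiation L2 :: (euclidean_space) real_inner
begin

definition scaleR_L2 :: "real \<Rightarrow> 'a L2 \<Rightarrow> 'a L2" where "scaleR r f = scaleC (of_real r) f"
definition inner_L2 :: "'a L2 \<Rightarrow> 'a L2 \<Rightarrow> real" where "inner f g = Re (cinner f g)"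
definition norm_L2 :: "'a L2 \<Rightarrow> real" where "norm f = sqrt (inner f (f :: 'a L2))"
definition sgn_L2 :: "'a L2 \<Rightarrow> 'a L2" where "sgn f = scaleR (inverse (norm f)) (f :: 'a L2)"
definition dist_L2 :: "'a L2 \<Rightarrow> 'a L2 \<Rightarrow> real" where "dist f g = norm (f - g :: 'a L2)"
definition uniformity_L2 :: "('a L2 \<times> 'a L2) filter" where
  "uniformity_L2 = (INF e\<in>{0<..}. principal {(f, g). dist f g < e})"
definition open_L2 :: "'a L2 set \<Rightarrow> bool" where
  "open_L2 S \<longleftrightarrow> (\<forall>f\<in>S. \<forall>\<^sub>F (f', g) in uniformity. f' = f \<longrightarrow> g \<in> S)"

instance
proof
  fix a b :: real and f g h :: "'a L2"
  show "a *\<^sub>R (f + g) = a *\<^sub>R f + a *\<^sub>R g"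
    unfolding scaleR_L2_def
    by transfer (auto simp: L2_rel_def distrib_left
        intro!: square_integrable_add square_integrable_cmult)
  show "(a + b) *\<^sub>R f = a *\<^sub>R f + b *\<^sub>R f"
    unfolding scaleR_L2_def
    by transfer (auto simp: L2_rel_def distrib_right
        intro!: square_integrable_add square_integrable_cmult simp flip: distrib_right of_real_add)
  show "a *\<^sub>R b *\<^sub>R f = (a * b) *\<^sub>R f"
    unfolding scaleR_L2_def of_real_mult
    by transfer (auto simp: L2_rel_def mult.assoc intro!: square_integrable_cmult)
  show "1 *\<^sub>R f = f"
    unfolding scaleR_L2_def of_real_1
    by transfer (auto simp: L2_rel_def)
  show "dist f g = norm (f - g)" by (rule dist_L2_def)
  show "sgn f = inverse (norm f) *\<^sub>R f" by (rule sgn_L2_def)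
  show "norm f = sqrt (inner f f)" by (rule norm_L2_def)
  show "uniformity = (INF e\<in>{0<..}. principal {(f, g :: 'a L2). dist f g < e})"
    by (rule uniformity_L2_def)
  show "open S \<longleftrightarrow> (\<forall>f\<in>S. \<forall>\<^sub>F (f', g) in uniformity. f' = f \<longrightarrow> g \<in> S)" for S :: "'a L2 set"
    by (rule open_L2_def)
  show "inner f g = inner g f"
    unfolding inner_L2_def by (subst cinner_commute) simp
  show "inner (f + g) h = inner f h + inner g h"
    unfolding inner_L2_def
    by (subst (1 2 3) cinner_commute) (simp add: cinner_add_right)
  show "inner (a *\<^sub>R f) g = a * inner f g"
    unfolding inner_L2_def scaleR_L2_def
    by (subst (1 2) cinner_commute) (simp add: cinner_scaleC_right)
  show "0 \<le> inner f f" unfolding inner_L2_def by (rule Re_cinner_self_nonneg)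
  show "inner f f = 0 \<longleftrightarrow> f = 0" unfolding inner_L2_def by (rule Re_cinner_self_eq_0)
qed

end

section \<open>Operators\<close>

text \<open>Multiplication by \<open>w\<close>; meaningful when \<open>w\<close> is bounded and Borel measurable.\<close>

definition mult_op :: "('a::euclidean_space \<Rightarrow> complex) \<Rightarrow> 'a L2 \<Rightarrow> 'a L2" where
  "mult_op w f = abs_L2 (\<lambda>x. w x * rep_L2 f x)"

definition positive_op :: "('a::euclidean_space L2 \<Rightarrow> 'a L2) \<Rightarrow> bool" where
  "positive_op A \<longleftrightarrow> (\<forall>f. cinner f (A f) \<in> \<real>\<^sub>\<ge>\<^sub>0)"

definition orthonormal_basis :: "'a::euclidean_space L2 set \<Rightarrow> bool" where
  "orthonormal_basis B \<longleftrightarrow>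
     (\<forall>e\<in>B. \<forall>e'\<in>B. cinner e e' = (if e = e' then 1 else 0)) \<and>
     (\<forall>f. ((\<lambda>e. scaleC (cinner e f) e) has_sum f) B)"

text \<open>The trace of a positive operator, with values in \<open>[0, \<infinity>]\<close>, is computed in an orthonormal
  basis and does not depend on the basis.\<close>

definition has_trace :: "('a::euclidean_space L2 \<Rightarrow> 'a L2) \<Rightarrow> ennreal \<Rightarrow> bool" where
  "has_trace A \<tau> \<longleftrightarrow>
     positive_op A \<and>
     (\<forall>B. orthonormal_basis B \<longrightarrow> (\<Sum>\<^sub>\<infinity>e\<in>B. ennreal (Re (cinner e (A e)))) = \<tau>)"

text \<open>The operator-valued integral \<open>\<integral>\<^sub>I F t dt = A\<close>, understood weakly.\<close>

definition has_op_integral ::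
    "(real \<Rightarrow> 'a::euclidean_space L2 \<Rightarrow> 'a L2) \<Rightarrow> ('a L2 \<Rightarrow> 'a L2) \<Rightarrow> real set \<Rightarrow> bool" where
  "has_op_integral F A I \<longleftrightarrow>
     (\<forall>f g. set_integrable lborel I (\<lambda>t. cinner f (F t g)) \<and>
            (LINT t:I|lborel. cinner f (F t g)) = cinner f (A g))"

definition unitary_op :: "('a::euclidean_space L2 \<Rightarrow> 'a L2) \<Rightarrow> bool" where
  "unitary_op U \<longleftrightarrow>
     (\<forall>f g. U (f + g) = U f + U g) \<and> (\<forall>c f. U (scaleC c f) = scaleC c (U f)) \<and>
     (\<forall>f g. cinner (U f) (U g) = cinner f g) \<and> surj U"

text \<open>An unbounded operator \<open>H\<close> is given by its graph.  The last clause says that the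
  generator of the group, domain included, is \<open>\<i> H\<close>, i.e. \<open>U t = exp (\<i> t H)\<close>.  By Stone's theorem
  there is exactly one such group for every self-adjoint \<open>H\<close>.\<close>

definition unitary_group_generated_by ::
    "('a::euclidean_space L2 \<times> 'a L2) set \<Rightarrow> (real \<Rightarrow> 'a L2 \<Rightarrow> 'a L2) \<Rightarrow> bool" where
  "unitary_group_generated_by H U \<longleftrightarrow>
     (\<forall>t. unitary_op (U t)) \<and> U 0 = id \<and> (\<forall>s t. U (s + t) = U s \<circ> U t) \<and>
     (\<forall>f. continuous_on UNIV (\<lambda>t. U t f)) \<and>
     (\<forall>f g. (f, g) \<in> H \<longleftrightarrow> ((\<lambda>t. U t f) has_vector_derivative scaleC \<i> g) (at 0))"

section \<open>The Hermite operator\<close>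

definition partial_deriv :: "'a::euclidean_space \<Rightarrow> ('a \<Rightarrow> complex) \<Rightarrow> 'a \<Rightarrow> complex" where
  "partial_deriv b \<phi> x = vector_derivative (\<lambda>t. \<phi> (x + t *\<^sub>R b)) (at 0)"

primrec C_k :: "nat \<Rightarrow> ('a::euclidean_space \<Rightarrow> complex) \<Rightarrow> bool" where
  "C_k 0 \<phi> \<longleftrightarrow> continuous_on UNIV \<phi>"
| "C_k (Suc k) \<phi> \<longleftrightarrow> continuous_on UNIV \<phi> \<and>
     (\<forall>b\<in>Basis. (\<forall>x. (\<lambda>t. \<phi> (x + t *\<^sub>R b)) differentiable (at 0)) \<and> C_k k (partial_deriv b \<phi>))"

definition test_functions :: "('a::euclidean_space \<Rightarrow> complex) set" where
  "test_functions = {\<phi>. (\<forall>k. C_k k \<phi>) \<and> (\<exists>K. compact K \<and> (\<forall>x. x \<notin> K \<longrightarrow> \<phi> x = 0))}"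

definition laplacian :: "('a::euclidean_space \<Rightarrow> complex) \<Rightarrow> 'a \<Rightarrow> complex" where
  "laplacian \<phi> x = (\<Sum>b\<in>Basis. partial_deriv b (partial_deriv b \<phi>) x)"

definition hermite_expr :: "('a::euclidean_space \<Rightarrow> complex) \<Rightarrow> 'a \<Rightarrow> complex" where
  "hermite_expr \<phi> x =
     - (1 / (4 * of_real pi)) * laplacian \<phi> x + of_real (pi * (norm x)\<^sup>2) * \<phi> x"

text \<open>The self-adjoint operator \<open>- \<Delta> / (4\<pi>) + \<pi> |x|\<^sup>2\<close>: its domain consists of the \<open>f\<close> in \<open>L\<^sup>2\<close> for
  which the expression, taken in the sense of distributions, is again in \<open>L\<^sup>2\<close>.  In other words it
  is the adjoint of the expression on the test functions; the latter operator being essentially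
  self-adjoint, this is also its closure and its only self-adjoint extension.\<close>

definition hermite_op :: "('a::euclidean_space L2 \<times> 'a L2) set" where
  "hermite_op =
     {(f, g). \<forall>\<phi>\<in>test_functions. cinner (abs_L2 (hermite_expr \<phi>)) f = cinner (abs_L2 \<phi>) g}"

section \<open>Bounded measurable functions of compact support\<close>

text \<open>Functions on \<open>\<Omega>\<close> are extended by zero.  For open \<open>\<Omega>\<close> the support is a compact subset of
  \<open>\<Omega>\<close>, so it stays away from the boundary.\<close>

definition Linf_c :: "'b::euclidean_space set \<Rightarrow> ('b \<Rightarrow> complex) set" where
  "Linf_c \<Omega> = {V. V \<in> borel_measurable borel \<and> bounded (range V) \<and>
     (\<exists>K. compact K \<and> K \<subseteq> \<Omega> \<and> (\<forall>z. z \<notin> K \<longrightarrow> V z = 0))}"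

end

theory Submission
  imports Defs "HOL-Probability.Distributions"
begin

text \<open>Write \<open>d\<close> for the dimension. The potential is the indicator function of \<open>[-1/2, 1/2]\<close> times the closed
  ball of radius \<open>2\<close>, and \<open>A\<close> denotes the integral of the conjugated potentials; it is a positive bounded
  operator. The reason for the infinite trace is a count in phase space. The Hermite group moves a
  Gaussian wave packet centred at the phase-space point \<open>(p, q)\<close> along the orbit of the classical harmonic
  oscillator, a rotation of phase space, without changing its shape (\<open>U_coherent_state\<close>). So
  \<open>\<langle>\<phi>, A \<phi>\<rangle>\<close> is, up to constants, at least the time that the orbit of the centre of \<open>\<phi>\<close> spends in the
  unit ball during the time window. An orbit with large momentum \<open>q\<close> that crosses the unit ball does so
  at speed about \<open>|q|\<close>, and the expectation is at least a constant times \<open>1/|q|\<close>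
  (\<open>window_op_coherent_lower_bound\<close>). By convexity of moments, \<open>\<langle>\<phi>, A\<^sup>n \<phi>\<rangle>\<close> is then at least a constant times
  \<open>|q|\<close> to the power \<open>-n\<close> (\<open>moment_inequality\<close>).

  The orbits through \<open>(p, q)\<close> that cross the ball in the window include those with \<open>p = n q/|q|\<close> for the
  integers \<open>n\<close> from \<open>0\<close> to \<open>|q|/2\<close>. Letting \<open>q\<close> run through the lattice points with positive coordinates,
  one gets about \<open>|q|\<close> well separated wave packets for each \<open>q\<close>, and for the power \<open>d + 1\<close> the sum of the
  expectations is at least a constant times the sum of \<open>|q| * |q|\<close> to the power \<open>-(d + 1)\<close>, which
  diverges logarithmically: each dyadic block of lattice points contributes at least a fixed positive
  amount (\<open>dyadic_block_sum\<close>).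

  It remains to compare this sum with the trace. The wave packets are not orthogonal, but their overlaps
  decay so fast in phase space that they satisfy a Bessel inequality with a constant that does not depend on
  how many of them are taken (\<open>lattice_state_bessel\<close>). For a family with Bessel constant \<open>M\<close> and a positive
  operator \<open>T\<close>, the sum of the expectations of \<open>T\<close> is at most \<open>M\<close> times the sum of the diagonal entries
  of \<open>T\<close> in any given orthonormal basis (\<open>bessel_family_trace_le\<close>). This treats every orthonormal basis at
  once; the proof splits off rank-one forms from the form of \<open>T\<close>.\<close>

section \<open>The Hilbert space and positive forms\<close>

lemma square_integrable_rep: "square_integrable (rep_L2 f)"
  using Quotient3_rep_reflp[OF Quotient3_L2, of f] by (simp add: L2_rel_def)

lemma abs_rep_L2: "abs_L2 (rep_L2 f) = f"
  by (rule Quotient3_abs_rep[OF Quotient3_L2])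

lemma abs_L2_eqI:
  assumes "square_integrable f" "square_integrable g" "AE x in lborel. f x = g x"
  shows "abs_L2 f = abs_L2 g"
  using assms by (intro Quotient3_rel_abs[OF Quotient3_L2]) (simp add: L2_rel_def)

lemma AE_rep_abs_L2:
  assumes "square_integrable f"
  shows "AE x in lborel. rep_L2 (abs_L2 f) x = f x"
proof -
  have "L2_rel (rep_L2 (abs_L2 f)) f"
    by (rule Quotient3_rep_abs[OF Quotient3_L2]) (use assms in \<open>simp add: L2_rel_def\<close>)
  then show ?thesis by (simp add: L2_rel_def)
qed

lemma L2_rel_refl: "square_integrable f \<Longrightarrow> L2_rel f f"
  by (simp add: L2_rel_def)

lemma L2_cases:
  obtains u where "square_integrable u" "f = abs_L2 u"
  using square_integrable_rep abs_rep_L2 by metis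

lemma cinner_abs:
  assumes "square_integrable f" "square_integrable g"
  shows "cinner (abs_L2 f) (abs_L2 g) = (LINT x|lborel. cnj (f x) * g x)"
  using cinner.abs_eq[OF L2_rel_refl L2_rel_refl] assms by blast

lemma plus_abs:
  assumes "square_integrable f" "square_integrable g"
  shows "abs_L2 f + abs_L2 g = abs_L2 (\<lambda>x. f x + g x)"
  using plus_L2.abs_eq[OF L2_rel_refl L2_rel_refl] assms by blast

lemma scaleC_abs:
  assumes "square_integrable f"
  shows "scaleC c (abs_L2 f) = abs_L2 (\<lambda>x. c * f x)"
  using scaleC.abs_eq[OF L2_rel_refl] assms by blast

lemma square_integrable_diff:
  assumes "square_integrable f" "square_integrable g"
  shows "square_integrable (\<lambda>x. f x - g x)"
  using square_integrable_add[OF assms(1) square_integrable_cmult[OF assms(2), of "-1"]] by simp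

lemma minus_abs:
  assumes "square_integrable f" "square_integrable g"
  shows "abs_L2 f - abs_L2 g = abs_L2 (\<lambda>x. f x - g x)"
  unfolding minus_L2_def uminus_L2_def scaleC_abs[OF assms(2)]
    plus_abs[OF assms(1) square_integrable_cmult[OF assms(2)]]
  by simp

lemma norm_abs_sq:
  assumes "square_integrable f"
  shows "(norm (abs_L2 f))\<^sup>2 = (LINT x|lborel. (cmod (f x))\<^sup>2)"
proof -
  have "(norm (abs_L2 f))\<^sup>2 = Re (LINT x|lborel. cnj (f x) * f x)"
    by (simp add: power2_norm_eq_inner inner_L2_def cinner_abs assms)
  also have "\<dots> = (LINT x|lborel. Re (cnj (f x) * f x))"
    by (intro integral_Re[symmetric] square_integrable_integrable_mult assms)
  also have "\<dots> = (LINT x|lborel. (cmod (f x))\<^sup>2)"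
    unfolding cmod_power2 by (simp add: power2_eq_square)
  finally show ?thesis .
qed

lemma scaleC_scaleC: "scaleC a (scaleC b f) = scaleC (a * b) f"
  by transfer (auto simp: L2_rel_def mult.assoc intro!: square_integrable_cmult)

lemma scaleC_one [simp]: "scaleC 1 f = f"
  by transfer (auto simp: L2_rel_def)

lemma scaleC_add_right: "scaleC c (f + g) = scaleC c f + scaleC c g"
  by transfer (auto simp: L2_rel_def distrib_left intro!: square_integrable_add square_integrable_cmult)

lemma scaleC_zero_left [simp]: "scaleC 0 f = 0"
  by transfer (auto simp: L2_rel_def square_integrable_zero)

lemma cinner_zero_right [simp]: "cinner f 0 = 0"
  using cinner_scaleC_right[of f 0 f] by simp

lemma cinner_add_left: "cinner (f + g) h = cinner f h + cinner g h"
  by (subst (1 2 3) cinner_commute) (simp add: cinner_add_right)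

lemma cinner_scaleC_left: "cinner (scaleC c f) g = cnj c * cinner f g"
  by (subst (1 2) cinner_commute) (simp add: cinner_scaleC_right)

lemma cinner_zero_left [simp]: "cinner 0 f = 0"
  by (subst cinner_commute) simp

lemma cinner_uminus_right: "cinner f (- g) = - cinner f g"
  by (simp add: uminus_L2_def cinner_scaleC_right)

lemma cinner_diff_right: "cinner f (g - h) = cinner f g - cinner f h"
  unfolding minus_L2_def cinner_add_right cinner_uminus_right by simp

lemma cinner_sum_right: "cinner f (sum g A) = (\<Sum>a\<in>A. cinner f (g a))"
  by (induction A rule: infinite_finite_induct) (auto simp: cinner_add_right)

lemma cinner_sum_left: "cinner (sum g A) f = (\<Sum>a\<in>A. cinner (g a) f)"
  by (induction A rule: infinite_finite_induct) (auto simp: cinner_add_left)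

lemma cinner_scaleR_right: "cinner f (r *\<^sub>R g) = of_real r * cinner f g"
  by (simp add: scaleR_L2_def cinner_scaleC_right)

lemma cinner_self: "cinner f f = of_real ((norm f)\<^sup>2)"
proof -
  have "Im (cinner f f) = 0"
    using arg_cong[OF cinner_commute[of f f], of Im] by simp
  then show ?thesis
    by (simp add: complex_eq_iff power2_norm_eq_inner inner_L2_def)
qed

lemma cinner_extensionality:
  assumes "\<And>h. cinner h f = cinner h g"
  shows "f = g"
proof -
  have "cinner (f - g) (f - g) = 0"
    using assms by (simp add: cinner_diff_right)
  then show ?thesis by (simp add: cinner_self)
qed

lemma mult_cnj_cmod: "z * cnj z = (complex_of_real (cmod z))\<^sup>2"
  by (metis complex_norm_square of_real_power)

lemma norm_scaleC: "norm (scaleC c f) = cmod c * norm f"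
proof -
  have "complex_of_real ((norm (scaleC c f))\<^sup>2) = c * cnj c * cinner f f"
    unfolding cinner_self[symmetric] cinner_scaleC_left cinner_scaleC_right by simp
  also have "\<dots> = of_real ((cmod c * norm f)\<^sup>2)"
    unfolding cinner_self
    by (simp add: power_mult_distrib mult_cnj_cmod)
  finally have "(norm (scaleC c f))\<^sup>2 = (cmod c * norm f)\<^sup>2"
    by (simp only: of_real_eq_iff)
  then show ?thesis by (rule power2_eq_imp_eq) auto
qed

text \<open>Both the comparison of traces and the moment inequality apply the Cauchy--Schwarz inequality to forms
  such as \<open>\<lambda>f g. cinner f (T g)\<close>; the former applies it also to the remainders that arise in an induction.\<close>

locale positive_form =
  fixes Q :: "'a::euclidean_space L2 \<Rightarrow> 'a L2 \<Rightarrow> complex"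
  assumes add_right: "Q f (g + h) = Q f g + Q f h"
    and scale_right: "Q f (scaleC c g) = c * Q f g"
    and hermitian: "Q g f = cnj (Q f g)"
    and nonneg: "0 \<le> Re (Q f f)"
begin

lemma zero_right [simp]: "Q f 0 = 0"
  using scale_right[of f 0 f] by simp

lemma sum_right: "Q f (sum g A) = (\<Sum>a\<in>A. Q f (g a))"
  by (induction A rule: infinite_finite_induct) (auto simp: add_right)

lemma add_left: "Q (f + g) h = Q f h + Q g h"
  by (subst (1 2 3) hermitian) (simp add: add_right)

lemma scale_left: "Q (scaleC c f) g = cnj c * Q f g"
  by (subst (1 2) hermitian) (simp add: scale_right)

lemma self_real: "Q f f = of_real (Re (Q f f))"
  using arg_cong[OF hermitian[of f f], of Im] by (simp add: complex_eq_iff)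

lemma Cauchy_Schwarz: "(cmod (Q f g))\<^sup>2 \<le> Re (Q f f) * Re (Q g g)"
proof -
  define a b z where "a = Re (Q f f)" and "b = Re (Q g g)" and "z = Q g f"
  \<comment> \<open>The form is nonnegative on \<open>f - s z g\<close> for every real \<open>s\<close>.\<close>
  have key: "0 \<le> a - 2 * s * (cmod z)\<^sup>2 + s\<^sup>2 * (cmod z)\<^sup>2 * b" for s :: real
  proof -
    have ff: "Q f f = of_real a" and gg: "Q g g = of_real b"
      unfolding a_def b_def by (rule self_real)+
    have fg: "Q f g = cnj z" and gf: "Q g f = z"
      unfolding z_def by (auto intro: hermitian)
    have "Q (f + scaleC (- of_real s * z) g) (f + scaleC (- of_real s * z) g)
        = of_real a - 2 * of_real s * (z * cnj z) + of_real s ^ 2 * (z * cnj z) * of_real b"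
      by (simp add: add_left add_right scale_left scale_right ff gg fg gf algebra_simps power2_eq_square)
    also have "\<dots> = of_real (a - 2 * s * (cmod z)\<^sup>2 + s\<^sup>2 * (cmod z)\<^sup>2 * b)"
      by (simp add: mult_cnj_cmod)
    finally show ?thesis
      using nonneg[of "f + scaleC (- of_real s * z) g"] by simp
  qed
  have z: "cmod (Q f g) = cmod z"
    using hermitian[of g f] by (simp add: z_def)
  have b: "b \<ge> 0" unfolding b_def by (rule nonneg)
  show ?thesis
  proof (cases "b = 0")
    case False
    then have "b > 0" using b by simp
    have "0 \<le> a - (cmod z)\<^sup>2 / b"
      \<comment> \<open>The minimum of the quadratic polynomial in \<open>s\<close>.\<close>
      using key[of "1/b"] \<open>b > 0\<close> by (simp add: power2_eq_square field_simps)
    then have "(cmod z)\<^sup>2 \<le> a * b" using \<open>b > 0\<close> by (simp add: field_simps)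
    then show ?thesis by (simp add: z a_def b_def)
  next
    case True
    have "(cmod z)\<^sup>2 = 0"
    proof (rule ccontr)
      assume "(cmod z)\<^sup>2 \<noteq> 0"
      \<comment> \<open>For \<open>b = 0\<close> the lower bound is linear in \<open>s\<close>; this value of \<open>s\<close> makes it \<open>-1\<close>.\<close>
      then show False using key[of "(a + 1) / (2 * (cmod z)\<^sup>2)"] True by (simp add: field_simps)
    qed
    then show ?thesis using True by (simp add: z a_def b_def)
  qed
qed

end

lemma positive_form_cinner: "positive_form cinner"
  by standard (rule cinner_add_right cinner_scaleC_right Re_cinner_self_nonneg cinner_commute)+

lemma cmod_cinner_le: "cmod (cinner f g) \<le> norm f * norm g"
proof -
  have "(cmod (cinner f g))\<^sup>2 \<le> (norm f * norm g)\<^sup>2"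
    using positive_form.Cauchy_Schwarz[OF positive_form_cinner, of f g]
    by (simp add: cinner_self power_mult_distrib)
  then show ?thesis by (rule power2_le_imp_le) auto
qed

lemma bounded_linear_cinner_right: "bounded_linear (cinner f)"
  by (rule bounded_linear_intro[where K = "norm f"])
     (auto simp: cinner_add_right cinner_scaleR_right scaleR_conv_of_real cmod_cinner_le
        mult.commute[of "norm x" "norm f" for x])

lemma bounded_linear_scaleC: "bounded_linear (scaleC c :: 'a::euclidean_space L2 \<Rightarrow> _)"
  by (rule bounded_linear_intro[where K = "cmod c"])
     (auto simp: scaleC_add_right scaleR_L2_def scaleC_scaleC norm_scaleC mult.commute)

section \<open>Bessel families and traces\<close>

definition bessel_family :: "real \<Rightarrow> ('i \<Rightarrow> 'a::euclidean_space L2) \<Rightarrow> 'i set \<Rightarrow> bool" where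
  "bessel_family M \<phi> F \<longleftrightarrow> (\<forall>f. (\<Sum>j\<in>F. (cmod (cinner (\<phi> j) f))\<^sup>2) \<le> M * (norm f)\<^sup>2)"

text \<open>For the coefficients \<open>c j = cinner (\<phi> j) f\<close> the sum of squares \<open>S\<close> equals \<open>cinner g f\<close> with
  \<open>g = (\<Sum>j. c j \<phi> j)\<close>. The Gram matrix of \<open>\<phi>\<close>, whose row sums are at most \<open>M\<close>, gives \<open>\<parallel>g\<parallel>\<^sup>2 \<le> M S\<close>, and the
  Cauchy--Schwarz inequality turns this into \<open>S \<le> M \<parallel>f\<parallel>\<^sup>2\<close>.\<close>

lemma bessel_family_Schur_test:
  fixes \<phi> :: "'i \<Rightarrow> 'a::euclidean_space L2"
  assumes "finite F" "0 \<le> M"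
    and row: "\<And>j. j \<in> F \<Longrightarrow> (\<Sum>k\<in>F. cmod (cinner (\<phi> j) (\<phi> k))) \<le> M"
  shows "bessel_family M \<phi> F"
  unfolding bessel_family_def
proof
  fix f :: "'a L2"
  define c where "c j = cinner (\<phi> j) f" for j
  define G where "G j k = cmod (cinner (\<phi> j) (\<phi> k))" for j k
  define g where "g = (\<Sum>j\<in>F. scaleC (c j) (\<phi> j))"
  define S where "S = (\<Sum>j\<in>F. (cmod (c j))\<^sup>2)"
  have G_sym: "G j k = G k j" for j k
    unfolding G_def by (subst cinner_commute) simp
  have S0: "0 \<le> S" unfolding S_def by (intro sum_nonneg) auto
  have "cinner g f = (\<Sum>j\<in>F. c j * cnj (c j))"
    by (simp add: g_def cinner_sum_left cinner_scaleC_left c_def mult.commute)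
  also have "\<dots> = of_real S"
    by (simp add: S_def mult_cnj_cmod)
  finally have S_le: "S \<le> norm g * norm f"
    using cmod_cinner_le[of g f] S0 by simp
  have "(norm g)\<^sup>2 = cmod (cinner g g)"
    by (simp add: cinner_self norm_power)
  also have "\<dots> = cmod (\<Sum>j\<in>F. \<Sum>k\<in>F. cnj (c j) * (c k * cinner (\<phi> j) (\<phi> k)))"
    unfolding g_def cinner_sum_left[where f = "sum _ _"] cinner_scaleC_left
    unfolding cinner_sum_right cinner_scaleC_right sum_distrib_left ..
  also have "\<dots> \<le> (\<Sum>j\<in>F. \<Sum>k\<in>F. cmod (c j) * (cmod (c k) * G j k))"
    unfolding G_def by (intro order_trans[OF norm_sum] sum_mono) (simp add: norm_mult)
  also have "\<dots> \<le> (\<Sum>j\<in>F. \<Sum>k\<in>F. ((cmod (c j))\<^sup>2 * G j k + (cmod (c k))\<^sup>2 * G j k) / 2)"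
  proof (intro sum_mono)
    fix j k
    have "cmod (c j) * cmod (c k) \<le> ((cmod (c j))\<^sup>2 + (cmod (c k))\<^sup>2) / 2"
      using sum_squares_bound[of "cmod (c j)" "cmod (c k)"] by simp
    then have "cmod (c j) * cmod (c k) * G j k \<le> ((cmod (c j))\<^sup>2 + (cmod (c k))\<^sup>2) / 2 * G j k"
      by (rule mult_right_mono) (simp add: G_def)
    then show "cmod (c j) * (cmod (c k) * G j k)
        \<le> ((cmod (c j))\<^sup>2 * G j k + (cmod (c k))\<^sup>2 * G j k) / 2"
      by (simp add: algebra_simps)
  qed
  also have "\<dots> = ((\<Sum>j\<in>F. \<Sum>k\<in>F. (cmod (c j))\<^sup>2 * G j k) + (\<Sum>j\<in>F. \<Sum>k\<in>F. (cmod (c k))\<^sup>2 * G j k)) / 2"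
    by (simp add: sum.distrib sum_divide_distrib[symmetric])
  also have "(\<Sum>j\<in>F. \<Sum>k\<in>F. (cmod (c k))\<^sup>2 * G j k) = (\<Sum>j\<in>F. \<Sum>k\<in>F. (cmod (c j))\<^sup>2 * G j k)"
    by (subst sum.swap) (simp add: G_sym)
  also have "((\<Sum>j\<in>F. \<Sum>k\<in>F. (cmod (c j))\<^sup>2 * G j k) + (\<Sum>j\<in>F. \<Sum>k\<in>F. (cmod (c j))\<^sup>2 * G j k)) / 2
      = (\<Sum>j\<in>F. (cmod (c j))\<^sup>2 * (\<Sum>k\<in>F. G j k))"
    by (subst field_sum_of_halves[symmetric]) (simp only: add_divide_distrib sum_distrib_left)
  also have "\<dots> \<le> (\<Sum>j\<in>F. (cmod (c j))\<^sup>2 * M)"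
    using row by (intro sum_mono mult_left_mono) (auto simp: G_def)
  also have "\<dots> = M * S" by (simp add: S_def sum_distrib_left mult.commute)
  finally have g_le: "(norm g)\<^sup>2 \<le> M * S" .
  have "S * S \<le> (norm g * norm f) * (norm g * norm f)"
    using S_le S0 by (intro mult_mono) auto
  also have "\<dots> = (norm g)\<^sup>2 * (norm f)\<^sup>2" by (simp add: power2_eq_square)
  also have "\<dots> \<le> M * S * (norm f)\<^sup>2" by (intro mult_right_mono g_le) auto
  finally have *: "S * S \<le> (M * (norm f)\<^sup>2) * S" by (simp add: mult_ac)
  show "(\<Sum>j\<in>F. (cmod (cinner (\<phi> j) f))\<^sup>2) \<le> M * (norm f)\<^sup>2"
  proof (cases "S = 0")
    case True then show ?thesis using assms(2) by (simp add: S_def c_def)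
  next
    case False
    then have "S > 0" using S0 by simp
    then have "S \<le> M * (norm f)\<^sup>2" using * by (simp add: mult_le_cancel_right)
    then show ?thesis by (simp add: S_def c_def)
  qed
qed

definition orthonormal :: "'a::euclidean_space L2 set \<Rightarrow> bool" where
  "orthonormal E \<longleftrightarrow> (\<forall>e\<in>E. \<forall>e'\<in>E. cinner e e' = (if e = e' then 1 else 0))"

definition ortho_proj :: "'a::euclidean_space L2 set \<Rightarrow> 'a L2 \<Rightarrow> 'a L2" where
  "ortho_proj E f = (\<Sum>e\<in>E. scaleC (cinner e f) e)"

lemma norm_orthonormal_sum:
  assumes "finite E" "orthonormal E"
  shows "(norm (\<Sum>e\<in>E. scaleC (a e) e))\<^sup>2 = (\<Sum>e\<in>E. (cmod (a e))\<^sup>2)"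
proof -
  have "complex_of_real ((norm (\<Sum>e\<in>E. scaleC (a e) e))\<^sup>2)
      = (\<Sum>e\<in>E. cnj (a e) * (\<Sum>e'\<in>E. a e' * cinner e e'))"
    unfolding cinner_self[symmetric] cinner_sum_left[where f = "sum _ _"] cinner_scaleC_left
    unfolding cinner_sum_right cinner_scaleC_right ..
  also have "\<dots> = (\<Sum>e\<in>E. cnj (a e) * (\<Sum>e'\<in>E. if e = e' then a e' else 0))"
    using assms(2) by (intro sum.cong arg_cong2[where f="(*)"] refl) (auto simp: orthonormal_def)
  also have "\<dots> = (\<Sum>e\<in>E. a e * cnj (a e))"
    using assms(1) by (simp add: mult.commute)
  also have "\<dots> = of_real (\<Sum>e\<in>E. (cmod (a e))\<^sup>2)"
    by (simp add: mult_cnj_cmod)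
  finally show ?thesis by (simp only: of_real_eq_iff)
qed

text \<open>The inner sum is the complex conjugate of \<open>cinner (\<phi> j) w\<close> for the vector \<open>w\<close> with the coefficients
  \<open>cnj (a e)\<close>, so this is the Bessel inequality for \<open>w\<close>.\<close>

lemma bessel_family_sum_rank_one:
  assumes "finite E" "orthonormal E" "bessel_family M \<phi> F"
  shows "(\<Sum>j\<in>F. (cmod (\<Sum>e\<in>E. cinner e (\<phi> j) * a e))\<^sup>2) \<le> M * (\<Sum>e\<in>E. (cmod (a e))\<^sup>2)"
proof -
  define w where "w = (\<Sum>e\<in>E. scaleC (cnj (a e)) e)"
  have "(\<Sum>e\<in>E. cinner e (\<phi> j) * a e) = cnj (cinner (\<phi> j) w)" for j
    by (simp add: w_def cinner_commute[symmetric] cinner_sum_left cinner_scaleC_left mult.commute)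
  then have "(\<Sum>j\<in>F. (cmod (\<Sum>e\<in>E. cinner e (\<phi> j) * a e))\<^sup>2) \<le> M * (norm w)\<^sup>2"
    using assms(3) by (simp add: bessel_family_def)
  also have "(norm w)\<^sup>2 = (\<Sum>e\<in>E. (cmod (a e))\<^sup>2)"
    unfolding w_def norm_orthonormal_sum[OF assms(1,2)] by simp
  finally show ?thesis .
qed

text \<open>Induction on \<open>E\<close>. The form \<open>Q\<close> is the sum of the rank-one form \<open>Q f e0 * Q e0 g / Q e0 e0\<close> and of a
  remainder \<open>Q'\<close>, its Schur complement, which is again positive by the Cauchy--Schwarz inequality and has
  \<open>e0\<close> in its kernel. So \<open>Q'\<close> only sees the projection to the span of \<open>E\<close>, and the induction
  hypothesis applies to it.\<close>

lemma bessel_family_form_le: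
  fixes Q :: "'a::euclidean_space L2 \<Rightarrow> 'a L2 \<Rightarrow> complex"
  assumes "finite E" "orthonormal E" "positive_form Q" "bessel_family M \<phi> F"
  shows "(\<Sum>j\<in>F. Re (Q (ortho_proj E (\<phi> j)) (ortho_proj E (\<phi> j)))) \<le> M * (\<Sum>e\<in>E. Re (Q e e))"
  using assms(1-3)
proof (induction E arbitrary: Q rule: finite_induct)
  case empty
  then show ?case by (simp add: ortho_proj_def positive_form.zero_right)
next
  case (insert e0 E)
  interpret Q: positive_form Q by fact
  define q where "q = Re (Q e0 e0)"
  \<comment> \<open>If \<open>q = 0\<close>, then \<open>Q e0 = 0\<close> by Cauchy--Schwarz, and \<open>Q' = Q\<close> since division by zero yields zero.\<close>
  define Q' where "Q' f g = Q f g - Q f e0 * Q e0 g / of_real q" for f g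
  have q0: "q \<ge> 0" unfolding q_def by (rule Q.nonneg)
  have qq: "Q e0 e0 = of_real q" unfolding q_def by (rule Q.self_real)
  have diag: "Re (Q' f f) = Re (Q f f) - (cmod (Q e0 f))\<^sup>2 / q" for f
  proof -
    have "Q' f f = Q f f - of_real ((cmod (Q e0 f))\<^sup>2 / q)"
      unfolding Q'_def Q.hermitian[of f e0] by (simp add: mult_cnj_cmod mult.commute[of "cnj _"])
    then show ?thesis by simp
  qed
  interpret Q': positive_form Q'
  proof
    fix f g h :: "'a L2" and c :: complex
    show "Q' f (g + h) = Q' f g + Q' f h"
      by (simp add: Q'_def Q.add_right algebra_simps add_divide_distrib)
    show "Q' f (scaleC c g) = c * Q' f g"
      by (simp add: Q'_def Q.scale_right algebra_simps)
    have "cnj (Q f g) = Q g f" "cnj (Q f e0) = Q e0 f" "cnj (Q e0 g) = Q g e0"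
      by (rule Q.hermitian[symmetric])+
    then show "Q' g f = cnj (Q' f g)"
      by (simp add: Q'_def)
    show "0 \<le> Re (Q' f f)"
      using Q.Cauchy_Schwarz[of e0 f] q0 Q.nonneg[of f]
      by (cases "q = 0") (auto simp: diag q_def[symmetric] field_simps)
  qed
  have Q'0: "Q' e0 g = 0" for g
  proof (cases "q = 0")
    case True
    then show ?thesis using Q.Cauchy_Schwarz[of e0 g] by (simp add: Q'_def q_def[symmetric])
  next
    case False
    then show ?thesis by (simp add: Q'_def qq)
  qed
  have Q'0': "Q' g e0 = 0" for g
    using Q'.hermitian[of g e0] by (simp add: Q'0)
  have orth: "orthonormal E" using insert.prems(1) by (auto simp: orthonormal_def)
  define P where "P = ortho_proj (insert e0 E)"
  have P: "P f = scaleC (cinner e0 f) e0 + ortho_proj E f" for f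
    using insert.hyps by (simp add: P_def ortho_proj_def)
  have Q'P: "Q' (P f) (P f) = Q' (ortho_proj E f) (ortho_proj E f)" for f
    by (simp add: P Q'.add_left Q'.add_right Q'.scale_left Q'.scale_right Q'0 Q'0')
  have QP: "Q e0 (P f) = (\<Sum>e\<in>insert e0 E. cinner e f * Q e0 e)" for f
    unfolding P_def ortho_proj_def by (simp only: Q.sum_right Q.scale_right)
  have "(\<Sum>j\<in>F. Re (Q (P (\<phi> j)) (P (\<phi> j))))
      = (\<Sum>j\<in>F. Re (Q' (P (\<phi> j)) (P (\<phi> j)))) + (\<Sum>j\<in>F. (cmod (Q e0 (P (\<phi> j))))\<^sup>2) / q"
    by (simp add: diag sum_divide_distrib sum_subtractf)
  also have "\<dots> \<le> M * (\<Sum>e\<in>E. Re (Q' e e)) + M * (\<Sum>e\<in>insert e0 E. (cmod (Q e0 e))\<^sup>2) / q"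
    unfolding Q'P QP
    by (intro add_mono divide_right_mono q0 insert.IH[OF orth Q'.positive_form_axioms]
        bessel_family_sum_rank_one[OF _ insert.prems(1) assms(4)]) (use insert.hyps in simp)
  also have "(\<Sum>e\<in>E. Re (Q' e e)) = (\<Sum>e\<in>insert e0 E. Re (Q' e e))"
    using insert.hyps by (simp add: Q'0)
  also have "M * \<dots> + M * (\<Sum>e\<in>insert e0 E. (cmod (Q e0 e))\<^sup>2) / q = M * (\<Sum>e\<in>insert e0 E. Re (Q e e))"
    unfolding diag sum_subtractf sum_divide_distrib[symmetric] by (simp add: algebra_simps)
  finally show ?case by (simp add: P_def)
qed

text \<open>The previous bound for finite \<open>E \<subseteq> B\<close> passes to the limit, since the projections of \<open>\<phi> j\<close> to the span
  of \<open>E\<close> converge to \<open>\<phi> j\<close>.\<close>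

lemma bessel_family_trace_le:
  fixes T :: "'a::euclidean_space L2 \<Rightarrow> 'a L2"
  assumes B: "orthonormal_basis B" and T: "bounded_linear T"
    and pos: "positive_form (\<lambda>f g. cinner f (T g))"
    and bessel: "finite F" "bessel_family M \<phi> F" "0 \<le> M"
    and trace: "\<And>E. finite E \<Longrightarrow> E \<subseteq> B \<Longrightarrow> (\<Sum>e\<in>E. Re (cinner e (T e))) \<le> \<tau>"
  shows "(\<Sum>j\<in>F. Re (cinner (\<phi> j) (T (\<phi> j)))) \<le> M * \<tau>"
proof (rule tendsto_upperbound)
  let ?L = "finite_subsets_at_top B"
  show "\<not> trivial_limit ?L" by simp
  have lim: "((\<lambda>E. ortho_proj E f) \<longlongrightarrow> f) ?L" for f
    using B unfolding orthonormal_basis_def has_sum_def ortho_proj_def by blast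
  have "((\<lambda>E. \<Sum>j\<in>F. inner (ortho_proj E (\<phi> j)) (T (ortho_proj E (\<phi> j)))) \<longlongrightarrow>
      (\<Sum>j\<in>F. inner (\<phi> j) (T (\<phi> j)))) ?L"
    by (intro tendsto_sum tendsto_inner lim bounded_linear.tendsto[OF T])
  then show "((\<lambda>E. \<Sum>j\<in>F. Re (cinner (ortho_proj E (\<phi> j)) (T (ortho_proj E (\<phi> j))))) \<longlongrightarrow>
      (\<Sum>j\<in>F. Re (cinner (\<phi> j) (T (\<phi> j))))) ?L"
    by (simp add: inner_L2_def)
  show "\<forall>\<^sub>F E in ?L. (\<Sum>j\<in>F. Re (cinner (ortho_proj E (\<phi> j)) (T (ortho_proj E (\<phi> j))))) \<le> M * \<tau>"
  proof (rule eventually_finite_subsets_at_top_weakI)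
    fix E assume E: "finite E" "E \<subseteq> B"
    then have "orthonormal E" using B unfolding orthonormal_basis_def orthonormal_def by blast
    from bessel_family_form_le[OF E(1) this pos bessel(2)]
    have "(\<Sum>j\<in>F. Re (cinner (ortho_proj E (\<phi> j)) (T (ortho_proj E (\<phi> j))))) \<le> M * (\<Sum>e\<in>E. Re (cinner e (T e)))" .
    also have "\<dots> \<le> M * \<tau>" by (intro mult_left_mono trace E bessel)
    finally show "(\<Sum>j\<in>F. Re (cinner (ortho_proj E (\<phi> j)) (T (ortho_proj E (\<phi> j))))) \<le> M * \<tau>" .
  qed
qed

text \<open>Two factors are removed at a time: \<open>cinner f ((A ^^ (n + 2)) g) = cinner (A f) ((A ^^ n) (A g))\<close>.\<close>

lemma positive_form_power:
  assumes pos: "positive_form (\<lambda>f g. cinner f (A g))"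
  shows "positive_form (\<lambda>f g. cinner f ((A ^^ n) g))"
proof (induction n rule: less_induct)
  case (less n)
  interpret positive_form "\<lambda>f g. cinner f (A g)" by fact
  have A_add: "A (f + g) = A f + A g" for f g
    by (rule cinner_extensionality) (simp add: add_right cinner_add_right)
  have A_scale: "A (scaleC c f) = scaleC c (A f)" for c f
    by (rule cinner_extensionality) (simp add: scale_right cinner_scaleC_right)
  have sym: "cinner (A f) g = cinner f (A g)" for f g
    using hermitian[of g f] cinner_commute[of "A f" g] by simp
  consider "n = 0" | "n = 1" | m where "n = Suc (Suc m)"
    by (metis One_nat_def not0_implies_Suc)
  then show ?case
  proof cases
    case 1 then show ?thesis by (simp add: positive_form_cinner)
  next
    case 2 then show ?thesis using pos by simp
  next
    case (3 m)
    interpret m: positive_form "\<lambda>f g. cinner f ((A ^^ m) g)" by (rule less.IH) (simp add: 3)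
    have n: "cinner f ((A ^^ n) g) = cinner (A f) ((A ^^ m) (A g))" for f g
      by (simp add: 3 sym funpow_swap1)
    show ?thesis
      unfolding n
    proof
      fix f g h c
      show "cinner (A f) ((A ^^ m) (A (g + h))) = cinner (A f) ((A ^^ m) (A g)) + cinner (A f) ((A ^^ m) (A h))"
        by (simp add: A_add m.add_right)
      show "cinner (A f) ((A ^^ m) (A (scaleC c g))) = c * cinner (A f) ((A ^^ m) (A g))"
        by (simp add: A_scale m.scale_right)
      show "cinner (A g) ((A ^^ m) (A f)) = cnj (cinner (A f) ((A ^^ m) (A g)))"
        by (rule m.hermitian)
      show "0 \<le> Re (cinner (A f) ((A ^^ m) (A f)))"
        by (rule m.nonneg)
    qed
  qed
qed

text \<open>The moments \<open>a n = cinner f ((A ^^ n) f)\<close> are logarithmically convex by the Cauchy--Schwarz inequality for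
  the form of \<open>A ^^ n\<close>. Hence the quotients \<open>a (n + 1) / a n\<close> increase and are at least \<open>a 1 / a 0\<close>. For a
  unit vector this is Jensen's inequality for the spectral measure of \<open>f\<close>.\<close>

lemma moment_inequality:
  assumes pos: "positive_form (\<lambda>f g. cinner f (A g))"
  shows "Re (cinner f (A f)) ^ Suc n \<le> ((norm f)\<^sup>2) ^ n * Re (cinner f ((A ^^ Suc n) f))"
proof -
  interpret positive_form "\<lambda>f g. cinner f (A g)" by fact
  have sym: "cinner (A f) g = cinner f (A g)" for f g
    using hermitian[of g f] cinner_commute[of "A f" g] by simp
  define a where "a n = Re (cinner f ((A ^^ n) f))" for n
  have a0: "0 \<le> a n" for n
    unfolding a_def by (rule positive_form.nonneg[OF positive_form_power[OF pos]])
  have log_convex: "(a (Suc n))\<^sup>2 \<le> a n * a (Suc (Suc n))" for n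
  proof -
    interpret m: positive_form "\<lambda>f g. cinner f ((A ^^ n) g)" by (rule positive_form_power[OF pos])
    have "(a (Suc n))\<^sup>2 \<le> (cmod (cinner f ((A ^^ n) (A f))))\<^sup>2"
      using a0[of "Suc n"] unfolding a_def
      by (intro power_mono) (auto simp: funpow_swap1 complex_Re_le_cmod)
    also have "\<dots> \<le> Re (cinner f ((A ^^ n) f)) * Re (cinner (A f) ((A ^^ n) (A f)))"
      by (rule m.Cauchy_Schwarz)
    also have "\<dots> = a n * a (Suc (Suc n))"
      by (simp add: a_def sym funpow_swap1)
    finally show ?thesis .
  qed
  have step: "a 1 * a n \<le> a 0 * a (Suc n)" for n
  proof (induction n)
    case 0 then show ?case by simp
  next
    case (Suc n)
    show ?case
    proof (cases "a n = 0")
      case True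
      then have "a (Suc n) = 0" using log_convex[of n] by simp
      then show ?thesis using a0 by simp
    next
      case False
      then have pos: "a n > 0" using a0[of n] by simp
      have "a n * (a 1 * a (Suc n)) = a (Suc n) * (a 1 * a n)" by simp
      also have "\<dots> \<le> a (Suc n) * (a 0 * a (Suc n))" by (intro mult_left_mono Suc a0)
      also have "\<dots> = a 0 * (a (Suc n))\<^sup>2" by (simp add: power2_eq_square)
      also have "\<dots> \<le> a 0 * (a n * a (Suc (Suc n)))" by (intro mult_left_mono log_convex a0)
      also have "\<dots> = a n * (a 0 * a (Suc (Suc n)))" by simp
      finally show ?thesis using pos by (simp only: mult_le_cancel_left_pos)
    qed
  qed
  have "a 1 ^ Suc n \<le> a 0 ^ n * a (Suc n)"
  proof (induction n)
    case 0 then show ?case by simp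
  next
    case (Suc n)
    have "a 1 ^ Suc (Suc n) = a 1 * a 1 ^ Suc n" by simp
    also have "\<dots> \<le> a 1 * (a 0 ^ n * a (Suc n))" by (intro mult_left_mono Suc a0)
    also have "\<dots> = a 0 ^ n * (a 1 * a (Suc n))" by simp
    also have "\<dots> \<le> a 0 ^ n * (a 0 * a (Suc (Suc n)))" by (intro mult_left_mono step zero_le_power a0)
    finally show ?case by (simp add: mult_ac)
  qed
  moreover have "a 0 = (norm f)\<^sup>2" by (simp add: a_def cinner_self)
  moreover have "a 1 = Re (cinner f (A f))" by (simp add: a_def)
  ultimately show ?thesis by (simp add: a_def)
qed

text \<open>A finite sum of the diagonal entries in some orthonormal basis would bound the expectations in all
  Bessel families that share the constant \<open>M\<close>.\<close>

lemma has_trace_infinite: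
  fixes T :: "'a::euclidean_space L2 \<Rightarrow> 'a L2"
  assumes T: "bounded_linear T" and pos: "positive_form (\<lambda>f g. cinner f (T g))" and "0 \<le> M"
    and large: "\<And>K. \<exists>F. finite F \<and> bessel_family M \<phi> F \<and> K < (\<Sum>j\<in>F. Re (cinner (\<phi> j) (T (\<phi> j))))"
  shows "has_trace T \<infinity>"
  unfolding has_trace_def
proof (intro conjI allI impI)
  interpret positive_form "\<lambda>f g. cinner f (T g)" by fact
  show "positive_op T"
    unfolding positive_op_def
  proof
    fix f
    show "cinner f (T f) \<in> \<real>\<^sub>\<ge>\<^sub>0" using nonneg[of f] by (subst self_real) simp
  qed
  fix B assume B: "orthonormal_basis (B :: 'a L2 set)"
  let ?S = "\<Sum>\<^sub>\<infinity>e\<in>B. ennreal (Re (cinner e (T e)))"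
  show "?S = \<infinity>"
  proof (rule ccontr)
    assume "?S \<noteq> \<infinity>"
    then obtain \<tau> where \<tau>: "?S = ennreal \<tau>" "0 \<le> \<tau>" by (cases ?S) auto
    have bound: "(\<Sum>e\<in>E. Re (cinner e (T e))) \<le> \<tau>" if E: "finite E" "E \<subseteq> B" for E
    proof -
      have "ennreal (\<Sum>e\<in>E. Re (cinner e (T e))) = (\<Sum>e\<in>E. ennreal (Re (cinner e (T e))))"
        by (rule sum_ennreal[symmetric]) (rule nonneg)
      also have "\<dots> \<le> ?S"
        by (subst nonneg_infsum_complete) (use E in \<open>auto intro: SUP_upper\<close>)
      finally show ?thesis using \<tau> by (simp add: ennreal_le_iff)
    qed
    obtain F where "finite F" "bessel_family M \<phi> F" "M * \<tau> < (\<Sum>j\<in>F. Re (cinner (\<phi> j) (T (\<phi> j))))"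
      using large by blast
    with bessel_family_trace_le[OF B T pos this(1,2) \<open>0 \<le> M\<close> bound]
    show False by simp
  qed
qed

section \<open>Completeness\<close>

lemma nn_integral_norm_sq:
  assumes "square_integrable f"
  shows "(\<integral>\<^sup>+x. ennreal ((cmod (f x))\<^sup>2) \<partial>lborel) = ennreal ((norm (abs_L2 f))\<^sup>2)"
  unfolding norm_abs_sq[OF assms]
  by (rule nn_integral_eq_integral) (use assms in \<open>auto simp: square_integrable_def\<close>)

lemma square_integrableI:
  assumes [measurable]: "f \<in> borel_measurable lborel"
    and "(\<integral>\<^sup>+x. ennreal ((cmod (f x))\<^sup>2) \<partial>lborel) < \<infinity>"
  shows "square_integrable f"
  unfolding square_integrable_def using assms
  by (auto simp: integrable_iff_bounded)

lemma norm_abs_le: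
  assumes "square_integrable f" "0 \<le> c" "(\<integral>\<^sup>+x. ennreal ((cmod (f x))\<^sup>2) \<partial>lborel) \<le> ennreal (c\<^sup>2)"
  shows "norm (abs_L2 f) \<le> c"
proof -
  have "(norm (abs_L2 f))\<^sup>2 \<le> c\<^sup>2"
    using assms by (simp add: nn_integral_norm_sq ennreal_le_iff)
  then show ?thesis using assms(2) by (rule power2_le_imp_le)
qed

text \<open>The argument of Riesz and Fischer: the increments are so small that they are summable at almost every
  point. The pointwise limit is the limit in \<open>L\<^sup>2\<close> by Fatou's lemma.\<close>

lemma L2_fast_Cauchy_converges:
  fixes X :: "nat \<Rightarrow> 'a::euclidean_space L2"
  assumes fast: "\<And>j k. k \<le> j \<Longrightarrow> norm (X j - X k) \<le> (1/2) ^ k"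
  shows "\<exists>L. X \<longlonglongrightarrow> L"
proof -
  define u where "u k = rep_L2 (X k)" for k
  have sq: "square_integrable (u k)" and X: "X k = abs_L2 (u k)" for k
    by (simp_all add: u_def square_integrable_rep abs_rep_L2)
  have [measurable]: "u k \<in> borel_measurable borel" for k
    using sq[of k] by (simp add: square_integrable_def)
  have diff: "(\<integral>\<^sup>+x. ennreal ((cmod (u j x - u k x))\<^sup>2) \<partial>lborel) \<le> ennreal (((1/2) ^ k)\<^sup>2)" if "k \<le> j" for j k
    using fast[OF that]
    by (simp add: nn_integral_norm_sq[OF square_integrable_diff[OF sq sq]] X minus_abs[OF sq sq] ennreal_le_iff
        power_mono)
  define d where "d k x = (cmod (u (Suc k) x - u k x))\<^sup>2" for k x
  have [measurable]: "d k \<in> borel_measurable borel" for k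
    unfolding d_def by measurable
  \<comment> \<open>With the weights \<open>2 ^ k\<close> a summable series of squares bounds the increments themselves.\<close>
  have "(\<integral>\<^sup>+x. (\<Sum>k. ennreal (2 ^ k * d k x)) \<partial>lborel) = (\<Sum>k. \<integral>\<^sup>+x. ennreal (2 ^ k * d k x) \<partial>lborel)"
    by (rule nn_integral_suminf) measurable
  also have "\<dots> \<le> (\<Sum>k. ennreal ((1/2) ^ k))"
  proof (intro suminf_le allI)
    fix k
    have "(\<integral>\<^sup>+x. ennreal (2 ^ k * d k x) \<partial>lborel) = (\<integral>\<^sup>+x. ennreal (2 ^ k) * ennreal (d k x) \<partial>lborel)"
      by (intro nn_integral_cong) (simp add: ennreal_mult d_def)
    also have "\<dots> = ennreal (2 ^ k) * (\<integral>\<^sup>+x. ennreal (d k x) \<partial>lborel)"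
      by (rule nn_integral_cmult) measurable
    also have "\<dots> \<le> ennreal (2 ^ k) * ennreal (((1/2) ^ k)\<^sup>2)"
      unfolding d_def by (intro mult_left_mono diff) auto
    also have "\<dots> = ennreal ((1/2) ^ k)"
      by (simp add: ennreal_mult[symmetric] power2_eq_square power_one_over field_simps)
    finally show "(\<integral>\<^sup>+x. ennreal (2 ^ k * d k x) \<partial>lborel) \<le> ennreal ((1/2) ^ k)" .
  qed auto
  also have "\<dots> = ennreal 2"
    by (subst suminf_ennreal2) (auto simp: suminf_geometric summable_geometric)
  finally have "(\<integral>\<^sup>+x. (\<Sum>k. ennreal (2 ^ k * d k x)) \<partial>lborel) \<noteq> \<infinity>"
    by (auto simp: top_unique)
  then have "AE x in lborel. (\<Sum>k. ennreal (2 ^ k * d k x)) \<noteq> \<infinity>"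
    by (intro nn_integral_PInf_AE) measurable
  then have conv: "AE x in lborel. convergent (\<lambda>k. u k x)"
  proof eventually_elim
    case (elim x)
    then have "summable (\<lambda>k. 2 ^ k * d k x)"
      by (intro summable_suminf_not_top) (auto simp: d_def)
    then have "summable (\<lambda>k. (1/2) ^ k + 2 ^ k * d k x)"
      by (intro summable_add summable_geometric) auto
    then have "summable (\<lambda>k. u (Suc k) x - u k x)"
    proof (rule summable_comparison_test'[where N = 0])
      fix k :: nat
      define c where "c = cmod (u (Suc k) x - u k x)"
      have c: "0 \<le> c" by (simp add: c_def)
      \<comment> \<open>The inequality of arithmetic and geometric mean.\<close>
      have "0 \<le> 2 ^ k * ((1/2) ^ k - c)\<^sup>2" by simp
      also have "\<dots> = (1/2) ^ k - 2 * c + 2 ^ k * c\<^sup>2"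
        by (simp add: power2_diff power_one_over power2_eq_square field_simps)
      finally show "norm (u (Suc k) x - u k x) \<le> (1/2) ^ k + 2 ^ k * d k x"
        using c by (simp add: c_def[symmetric] d_def)
    qed
    then have "convergent (\<lambda>n. \<Sum>k<n. u (Suc k) x - u k x)"
      by (simp add: summable_iff_convergent)
    then have "convergent (\<lambda>n. (\<Sum>k<n. u (Suc k) x - u k x) + u 0 x)"
      by (intro convergent_add convergent_const)
    then show ?case unfolding sum_lessThan_telescope[of "\<lambda>k. u k x"] by simp
  qed
  define v where "v x = lim (\<lambda>k. u k x)" for x
  have [measurable]: "v \<in> borel_measurable borel"
    unfolding v_def by measurable
  have v_diff: "(\<integral>\<^sup>+x. ennreal ((cmod (v x - u k x))\<^sup>2) \<partial>lborel) \<le> ennreal (((1/2) ^ k)\<^sup>2)" for k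
  proof -
    have "(\<integral>\<^sup>+x. ennreal ((cmod (v x - u k x))\<^sup>2) \<partial>lborel)
        = (\<integral>\<^sup>+x. liminf (\<lambda>j. ennreal ((cmod (u j x - u k x))\<^sup>2)) \<partial>lborel)"
    proof (rule nn_integral_cong_AE)
      show "AE x in lborel. ennreal ((cmod (v x - u k x))\<^sup>2) = liminf (\<lambda>j. ennreal ((cmod (u j x - u k x))\<^sup>2))"
        using conv
      proof eventually_elim
        case (elim x)
        then have "(\<lambda>j. u j x) \<longlonglongrightarrow> v x" by (simp add: v_def convergent_LIMSEQ_iff)
        then have "(\<lambda>j. ennreal ((cmod (u j x - u k x))\<^sup>2)) \<longlonglongrightarrow> ennreal ((cmod (v x - u k x))\<^sup>2)"
          by (intro tendsto_ennrealI tendsto_intros)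
        then show ?case by (intro lim_imp_Liminf[symmetric]) auto
      qed
    qed
    also have "\<dots> \<le> liminf (\<lambda>j. \<integral>\<^sup>+x. ennreal ((cmod (u j x - u k x))\<^sup>2) \<partial>lborel)"
      by (rule nn_integral_liminf) measurable
    also have "\<dots> \<le> ennreal (((1/2) ^ k)\<^sup>2)"
    proof -
      have "\<forall>\<^sub>F j in sequentially. (\<integral>\<^sup>+x. ennreal ((cmod (u j x - u k x))\<^sup>2) \<partial>lborel) \<le> ennreal (((1/2) ^ k)\<^sup>2)"
        using eventually_ge_at_top[of k] by eventually_elim (rule diff)
      then have "liminf (\<lambda>j. \<integral>\<^sup>+x. ennreal ((cmod (u j x - u k x))\<^sup>2) \<partial>lborel)
          \<le> liminf (\<lambda>j::nat. ennreal (((1/2) ^ k)\<^sup>2))"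
        by (rule Liminf_mono)
      then show ?thesis by (simp add: Liminf_const)
    qed
    finally show ?thesis .
  qed
  have sq_diff: "square_integrable (\<lambda>x. v x - u k x)" for k
  proof (rule square_integrableI)
    show "(\<integral>\<^sup>+x. ennreal ((cmod (v x - u k x))\<^sup>2) \<partial>lborel) < \<infinity>"
      by (rule le_less_trans[OF v_diff]) simp
  qed measurable
  have sq_v: "square_integrable v"
    using square_integrable_add[OF sq_diff[of 0] sq[of 0]] by simp
  have bound: "norm (X k - abs_L2 v) \<le> (1/2) ^ k" for k
  proof -
    have "norm (abs_L2 (\<lambda>x. v x - u k x)) \<le> (1/2) ^ k"
      by (rule norm_abs_le[OF sq_diff _ v_diff]) simp
    then show ?thesis by (simp add: X minus_abs[OF sq_v sq, symmetric] norm_minus_commute)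
  qed
  have "(\<lambda>k. X k - abs_L2 v) \<longlonglongrightarrow> 0"
  proof (rule Lim_null_comparison)
    show "\<forall>\<^sub>F k in sequentially. norm (X k - abs_L2 v) \<le> (1/2) ^ k" using bound by simp
    show "(\<lambda>k. (1/2::real) ^ k) \<longlonglongrightarrow> 0" by (rule LIMSEQ_realpow_zero) auto
  qed
  then show ?thesis by (subst (asm) Lim_null[symmetric]) auto
qed

text \<open>Completeness is what makes continuous functions from an interval to \<open>L\<^sup>2\<close> integrable; the operator \<open>A\<close> is
  constructed as such an integral.\<close>

instance L2 :: (euclidean_space) banach
proof
  fix X :: "nat \<Rightarrow> 'a L2"
  assume X: "Cauchy X"
  have "\<exists>N. \<forall>m\<ge>N. \<forall>n\<ge>N. norm (X m - X n) < (1/2) ^ k" for k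
    using CauchyD[OF X, of "(1/2) ^ k"] by simp
  then obtain N where N: "\<And>k m n. N k \<le> m \<Longrightarrow> N k \<le> n \<Longrightarrow> norm (X m - X n) < (1/2) ^ k"
    by metis
  define r where "r k = (\<Sum>i\<le>k. N i) + k" for k
  have "strict_mono r" unfolding strict_mono_Suc_iff r_def by simp
  have r: "N k \<le> r k" for k
    unfolding r_def by (rule trans_le_add1) (rule member_le_sum, auto)
  have "\<exists>L. (\<lambda>k. X (r k)) \<longlonglongrightarrow> L"
  proof (rule L2_fast_Cauchy_converges)
    fix j k :: nat assume "k \<le> j"
    then have "r k \<le> r j" using \<open>strict_mono r\<close> by (simp add: strict_mono_less_eq)
    then show "norm (X (r j) - X (r k)) \<le> (1/2) ^ k"
      using N[of k "r j" "r k"] r[of k] by simp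
  qed
  then obtain L where "(X \<circ> r) \<longlonglongrightarrow> L" by (auto simp: o_def)
  then have "X \<longlonglongrightarrow> L" by (rule Cauchy_converges_subseq[OF X \<open>strict_mono r\<close>])
  then show "convergent X" by (auto simp: convergent_def)
qed

section \<open>Averages of evolved cut-offs\<close>

lemma square_integrable_mult_bounded:
  assumes [measurable]: "w \<in> borel_measurable borel" and w: "\<And>x. cmod (w x) \<le> C"
    and f: "square_integrable f"
  shows "square_integrable (\<lambda>x. w x * f x)"
proof -
  have [measurable]: "f \<in> borel_measurable borel" using f by (simp add: square_integrable_def)
  have "integrable lborel (\<lambda>x. C\<^sup>2 * (cmod (f x))\<^sup>2)"
    using f by (auto simp: square_integrable_def)
  then have "integrable lborel (\<lambda>x. (cmod (w x * f x))\<^sup>2)"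
  proof (rule Bochner_Integration.integrable_bound)
    show "AE x in lborel. norm ((cmod (w x * f x))\<^sup>2) \<le> norm (C\<^sup>2 * (cmod (f x))\<^sup>2)"
      using w by (intro AE_I2) (simp add: norm_mult power_mult_distrib mult_right_mono power_mono)
  qed measurable
  then show ?thesis by (simp add: square_integrable_def)
qed

lemma mult_op_abs:
  assumes [measurable]: "w \<in> borel_measurable borel" and w: "\<And>x. cmod (w x) \<le> C"
    and f: "square_integrable f"
  shows "mult_op w (abs_L2 f) = abs_L2 (\<lambda>x. w x * f x)"
  unfolding mult_op_def
proof (rule abs_L2_eqI)
  show "square_integrable (\<lambda>x. w x * rep_L2 (abs_L2 f) x)" "square_integrable (\<lambda>x. w x * f x)"
    by (rule square_integrable_mult_bounded[OF assms(1) w], rule square_integrable_rep f)+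
  show "AE x in lborel. w x * rep_L2 (abs_L2 f) x = w x * f x"
    using AE_rep_abs_L2[OF f] by eventually_elim simp
qed

abbreviation restrict_op :: "'a::euclidean_space set \<Rightarrow> 'a L2 \<Rightarrow> 'a L2" where
  "restrict_op S \<equiv> mult_op (\<lambda>x. indicator S x)"

context
  fixes S :: "'a::euclidean_space set"
  assumes S [measurable]: "S \<in> sets borel"
begin

lemma square_integrable_restrict: "square_integrable f \<Longrightarrow> square_integrable (\<lambda>x. indicator S x * f x)"
  by (rule square_integrable_mult_bounded[where C = 1]) (auto simp: indicator_def)

lemma restrict_op_abs: "square_integrable f \<Longrightarrow> restrict_op S (abs_L2 f) = abs_L2 (\<lambda>x. indicator S x * f x)"
  by (rule mult_op_abs[where C = 1]) (auto simp: indicator_def)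

lemma restrict_op_add: "restrict_op S (f + g) = restrict_op S f + restrict_op S g"
proof -
  obtain u v where "square_integrable u" "f = abs_L2 u" "square_integrable v" "g = abs_L2 v"
    by (metis L2_cases)
  then show ?thesis
    by (simp add: restrict_op_abs plus_abs square_integrable_restrict square_integrable_add distrib_left)
qed

lemma restrict_op_scaleC: "restrict_op S (scaleC c f) = scaleC c (restrict_op S f)"
proof -
  obtain u where "square_integrable u" "f = abs_L2 u" by (rule L2_cases)
  then show ?thesis
    by (simp add: restrict_op_abs scaleC_abs square_integrable_restrict square_integrable_cmult mult.left_commute)
qed

lemma cinner_restrict_op:
  assumes "square_integrable u" "square_integrable v"
  shows "cinner (abs_L2 u) (restrict_op S (abs_L2 v)) = (LINT x|lborel. indicator S x * (cnj (u x) * v x))"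
  using assms by (simp add: restrict_op_abs cinner_abs square_integrable_restrict mult.left_commute)

lemma Re_cinner_restrict_op:
  assumes u: "square_integrable u"
  shows "Re (cinner (abs_L2 u) (restrict_op S (abs_L2 u))) = (LINT x|lborel. indicator S x * (cmod (u x))\<^sup>2)"
proof -
  have "integrable lborel (\<lambda>x. cnj (u x) * (indicator S x * u x))"
    using u by (intro square_integrable_integrable_mult square_integrable_restrict)
  then have int: "integrable lborel (\<lambda>x. indicator S x * (cnj (u x) * u x))"
    by (simp add: mult.left_commute)
  show ?thesis
    unfolding cinner_restrict_op[OF u u] integral_Re[OF int, symmetric]
    by (intro Bochner_Integration.integral_cong refl) (auto simp: indicator_def cmod_power2 simp flip: power2_eq_square)
qed

lemma restrict_op_hermitian: "cinner f (restrict_op S g) = cnj (cinner g (restrict_op S f))"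
proof -
  obtain u v where uv: "square_integrable u" "f = abs_L2 u" "square_integrable v" "g = abs_L2 v"
    by (metis L2_cases)
  have "cnj (LINT x|lborel. indicator S x * (cnj (v x) * u x)) = (LINT x|lborel. cnj (indicator S x * (cnj (v x) * u x)))"
    by (rule Bochner_Integration.integral_cnj[symmetric])
  also have "\<dots> = (LINT x|lborel. indicator S x * (cnj (u x) * v x))"
    by (intro Bochner_Integration.integral_cong refl) (auto simp: indicator_def)
  finally show ?thesis using uv by (simp add: cinner_restrict_op)
qed

lemma Re_cinner_restrict_op_nonneg: "0 \<le> Re (cinner f (restrict_op S f))"
proof -
  obtain u where u: "square_integrable u" "f = abs_L2 u" by (rule L2_cases)
  show ?thesis unfolding u(2) Re_cinner_restrict_op[OF u(1)]
    by (intro Bochner_Integration.integral_nonneg) simp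
qed

lemma norm_restrict_op_le: "norm (restrict_op S f) \<le> norm f"
proof -
  obtain u where u: "square_integrable u" "f = abs_L2 u" by (rule L2_cases)
  have "(\<integral>\<^sup>+x. ennreal ((cmod (indicator S x * u x))\<^sup>2) \<partial>lborel) \<le> (\<integral>\<^sup>+x. ennreal ((cmod (u x))\<^sup>2) \<partial>lborel)"
    by (intro nn_integral_mono) (auto simp: indicator_def)
  then have "(\<integral>\<^sup>+x. ennreal ((cmod (indicator S x * u x))\<^sup>2) \<partial>lborel) \<le> ennreal ((norm f)\<^sup>2)"
    by (simp add: u nn_integral_norm_sq)
  then show ?thesis
    unfolding u(2) restrict_op_abs[OF u(1)]
    by (intro norm_abs_le square_integrable_restrict u) auto
qed

end

locale hermite_group =
  fixes U :: "real \<Rightarrow> 'a::euclidean_space L2 \<Rightarrow> 'a L2"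
  assumes generated: "unitary_group_generated_by hermite_op U"
begin

lemma U_add: "U t (f + g) = U t f + U t g"
  and U_scaleC: "U t (scaleC c f) = scaleC c (U t f)"
  and cinner_U: "cinner (U t f) (U t g) = cinner f g"
  and U_0 [simp]: "U 0 f = f"
  and U_U: "U s (U t f) = U (s + t) f"
  and continuous_U: "continuous_on UNIV (\<lambda>t. U t f)"
  and generator: "(f, g) \<in> hermite_op \<longleftrightarrow> ((\<lambda>t. U t f) has_vector_derivative scaleC \<i> g) (at 0)"
  using generated by (auto simp: unitary_group_generated_by_def unitary_op_def)

lemma norm_U [simp]: "norm (U t f) = norm f"
  by (simp add: norm_L2_def inner_L2_def cinner_U)

lemma U_zero [simp]: "U t 0 = 0"
  using U_scaleC[of t 0 0] by simp

lemma U_diff: "U t (f - g) = U t f - U t g"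
proof -
  have "U t (f - g) + U t g = U t f" by (simp flip: U_add)
  then show ?thesis by (simp add: eq_diff_eq)
qed

lemma cinner_U_left: "cinner f (U (- t) g) = cinner (U t f) g"
  using cinner_U[of "t" f "U (- t) g"] by (simp add: U_U)

definition evolved :: "'a set \<Rightarrow> real \<Rightarrow> 'a L2 \<Rightarrow> 'a L2" where
  "evolved S t f = U (- t) (restrict_op S (U t f))"

text \<open>Strong continuity of the group makes \<open>evolved S t f\<close> continuous in \<open>t\<close>, so its average over \<open>[-T, T]\<close> is the
  integral of a continuous function with values in \<open>L\<^sup>2\<close>.\<close>

definition window_op :: "real \<Rightarrow> 'a set \<Rightarrow> 'a L2 \<Rightarrow> 'a L2" where
  "window_op T S f = integral {-T..T} (\<lambda>t. evolved S t f)"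

context
  fixes S :: "'a set" and T :: real
  assumes S [measurable]: "S \<in> sets borel" and T: "0 \<le> T"
begin

lemma norm_evolved_le: "norm (evolved S t f) \<le> norm f"
  using norm_restrict_op_le[OF S, of "U t f"] by (simp add: evolved_def)

lemma cinner_evolved: "cinner f (evolved S t g) = cinner (U t f) (restrict_op S (U t g))"
  by (simp add: evolved_def cinner_U_left)

lemma continuous_evolved: "continuous_on X (\<lambda>t. evolved S t f)"
proof (rule continuous_at_imp_continuous_on, rule ballI)
  fix s
  define h where "h = restrict_op S (U s f)"
  have U: "((\<lambda>t. U t g) \<longlongrightarrow> U s g) (at s)" for s g
    using continuous_U[of g] by (simp add: continuous_on_def)
  have "((\<lambda>t. U (- t) h) \<longlongrightarrow> U (- s) h) (at s)"
    by (rule isCont_tendsto_compose[of "- s" "\<lambda>t. U t h" "\<lambda>t. - t"])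
       (auto intro!: tendsto_intros simp: isCont_def U)
  then have "((\<lambda>t. norm (U t f - U s f) + norm (U (- t) h - U (- s) h)) \<longlongrightarrow> norm (U s f - U s f) + norm (U (- s) h - U (- s) h)) (at s)"
    by (intro tendsto_intros U)
  then have lim: "((\<lambda>t. norm (U t f - U s f) + norm (U (- t) h - U (- s) h)) \<longlongrightarrow> 0) (at s)"
    by simp
  have "((\<lambda>t. evolved S t f - evolved S s f) \<longlongrightarrow> 0) (at s)"
  proof (rule Lim_null_comparison[OF _ lim], rule always_eventually, rule allI)
    fix t
    have "restrict_op S (U t f) = restrict_op S (U t f - U s f) + h"
      by (simp add: h_def flip: restrict_op_add[OF S])
    then have "evolved S t f - evolved S s f
        = U (- t) (restrict_op S (U t f - U s f)) + (U (- t) h - U (- s) h)"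
      by (simp add: evolved_def U_add h_def)
    then have "norm (evolved S t f - evolved S s f)
        \<le> norm (restrict_op S (U t f - U s f)) + norm (U (- t) h - U (- s) h)"
      by (metis norm_triangle_ineq norm_U)
    also have "\<dots> \<le> norm (U t f - U s f) + norm (U (- t) h - U (- s) h)"
      by (intro add_right_mono norm_restrict_op_le S)
    finally show "norm (evolved S t f - evolved S s f) \<le> norm (U t f - U s f) + norm (U (- t) h - U (- s) h)" .
  qed
  then show "isCont (\<lambda>t. evolved S t f) s"
    by (simp add: isCont_def LIM_zero_iff)
qed

lemma evolved_integrable: "(\<lambda>t. evolved S t f) integrable_on {a..b}"
  by (intro integrable_continuous_interval continuous_evolved)

lemma cinner_window_op: "cinner f (window_op T S g) = integral {-T..T} (\<lambda>t. cinner f (evolved S t g))"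
  unfolding window_op_def
  using integral_linear[OF evolved_integrable bounded_linear_cinner_right] by (simp add: o_def)

lemma continuous_cinner_evolved: "continuous_on X (\<lambda>t. cinner f (evolved S t g))"
  by (rule bounded_linear.continuous_on[OF bounded_linear_cinner_right continuous_evolved])

lemma evolved_add: "evolved S t (f + g) = evolved S t f + evolved S t g"
  by (simp add: evolved_def U_add restrict_op_add S)

lemma evolved_scaleC: "evolved S t (scaleC c f) = scaleC c (evolved S t f)"
  by (simp add: evolved_def U_scaleC restrict_op_scaleC S)

lemma window_op_add: "window_op T S (f + g) = window_op T S f + window_op T S g"
  unfolding window_op_def evolved_add
  by (rule Henstock_Kurzweil_Integration.integral_add[OF evolved_integrable evolved_integrable])

lemma window_op_scaleC: "window_op T S (scaleC c f) = scaleC c (window_op T S f)"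
  unfolding window_op_def evolved_scaleC
  using integral_linear[OF evolved_integrable bounded_linear_scaleC] by (simp add: o_def)

lemma bounded_linear_window_op: "bounded_linear (window_op T S)"
proof (rule bounded_linear_intro[where K = "2 * T"])
  fix f
  have "norm (window_op T S f) \<le> norm f * (T - - T)"
    unfolding window_op_def using T
    by (intro integral_bound continuous_evolved) (auto intro: norm_evolved_le)
  then show "norm (window_op T S f) \<le> norm f * (2 * T)" by (simp add: algebra_simps)
qed (auto simp: window_op_add window_op_scaleC scaleR_L2_def)

lemma positive_form_window_op: "positive_form (\<lambda>f g. cinner f (window_op T S g))"
proof
  fix f g h c
  show "cinner f (window_op T S (g + h)) = cinner f (window_op T S g) + cinner f (window_op T S h)"
    by (simp add: window_op_add cinner_add_right)
  show "cinner f (window_op T S (scaleC c g)) = c * cinner f (window_op T S g)"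
    by (simp add: window_op_scaleC cinner_scaleC_right)
  have "cnj (integral {-T..T} (\<lambda>t. cinner f (evolved S t g))) = integral {-T..T} (\<lambda>t. cnj (cinner f (evolved S t g)))"
    using integral_linear[OF integrable_continuous_interval[OF continuous_cinner_evolved] bounded_linear_cnj]
    by (simp add: o_def)
  then show "cinner g (window_op T S f) = cnj (cinner f (window_op T S g))"
    unfolding cinner_window_op cinner_evolved by (simp add: restrict_op_hermitian[OF S, of "U _ g"])
  show "0 \<le> Re (cinner f (window_op T S f))"
  proof -
    have "Re (cinner f (window_op T S f)) = integral {-T..T} (\<lambda>t. Re (cinner f (evolved S t f)))"
      unfolding cinner_window_op
      using integral_linear[OF integrable_continuous_interval[OF continuous_cinner_evolved] bounded_linear_Re]
      by (simp add: o_def)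
    also have "\<dots> \<ge> 0"
      unfolding cinner_evolved
      by (intro Henstock_Kurzweil_Integration.integral_nonneg Re_cinner_restrict_op_nonneg S
          integrable_continuous_interval continuous_on_Re continuous_cinner_evolved[unfolded cinner_evolved])
    finally show ?thesis .
  qed
qed

lemma window_op_lower_bound:
  assumes ab: "-T \<le> a" "a \<le> b" "b \<le> T" and c: "\<And>t. t \<in> {a..b} \<Longrightarrow> c \<le> Re (cinner (U t f) (restrict_op S (U t f)))"
  shows "c * (b - a) \<le> Re (cinner f (window_op T S f))"
proof -
  have int: "(\<lambda>t. Re (cinner f (evolved S t f))) integrable_on {u..v}" for u v
    by (intro integrable_continuous_interval continuous_on_Re continuous_cinner_evolved)
  have "c * (b - a) = integral {a..b} (\<lambda>t. c)" using ab by simp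
  also have "\<dots> \<le> integral {a..b} (\<lambda>t. Re (cinner f (evolved S t f)))"
    by (intro integral_le int) (auto simp: cinner_evolved c)
  also have "\<dots> \<le> integral {-T..T} (\<lambda>t. Re (cinner f (evolved S t f)))"
    using ab by (intro integral_subset_le int) (auto simp: cinner_evolved Re_cinner_restrict_op_nonneg S)
  also have "\<dots> = Re (cinner f (window_op T S f))"
    unfolding cinner_window_op
    using integral_linear[OF integrable_continuous_interval[OF continuous_cinner_evolved] bounded_linear_Re]
    by (simp add: o_def)
  finally show ?thesis .
qed

text \<open>The window and the cut-off are joined into one potential on space-time. Outside the window the potential
  vanishes, so that enlarging the interval of integration has no effect.\<close>

lemma has_op_integral_window_op:
  assumes I: "{-T..T} \<subseteq> I"
  shows "has_op_integral (\<lambda>t. U (-t) \<circ> mult_op (\<lambda>x. indicator ({-T..T} \<times> S) (t, x)) \<circ> U t) (window_op T S) I"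
  unfolding has_op_integral_def
proof (intro allI)
  fix f g
  let ?F = "\<lambda>t. U (-t) \<circ> mult_op (\<lambda>x. indicator ({-T..T} \<times> S) (t, x)) \<circ> U t"
  have F: "indicator I t *\<^sub>R cinner f (?F t g) = indicator {-T..T} t *\<^sub>R cinner f (evolved S t g)" for t
  proof (cases "t \<in> {-T..T}")
    case True
    then have "(\<lambda>x. indicator ({-T..T} \<times> S) (t, x) :: complex) = (\<lambda>x. indicator S x)"
      by (auto simp: indicator_def)
    then show ?thesis using True I by (auto simp: evolved_def)
  next
    case False
    then have "(\<lambda>x. indicator ({-T..T} \<times> S) (t, x) :: complex) = (\<lambda>x. indicator {} x)"
      by (auto simp: indicator_def)
    moreover have "restrict_op {} h = 0" for h :: "'a L2"
      by (rule L2_cases[of h]) (simp add: zero_L2_def mult_op_abs[where C = 0])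
    ultimately show ?thesis using False by simp
  qed
  have int: "set_integrable lborel {-T..T} (\<lambda>t. cinner f (evolved S t g))"
    by (rule borel_integrable_atLeastAtMost') (rule continuous_cinner_evolved)
  have "set_integrable lborel I (\<lambda>t. cinner f (?F t g))"
    using int unfolding set_integrable_def F .
  moreover have "(LINT t:I|lborel. cinner f (?F t g)) = (LINT t:{-T..T}|lborel. cinner f (evolved S t g))"
    unfolding set_lebesgue_integral_def F ..
  moreover have "\<dots> = cinner f (window_op T S g)"
    unfolding cinner_window_op by (rule set_borel_integral_eq_integral(2)[OF int])
  ultimately show "set_integrable lborel I (\<lambda>t. cinner f (?F t g)) \<and>
      (LINT t:I|lborel. cinner f (?F t g)) = cinner f (window_op T S g)" by simp
qed

end

end

section \<open>Gaussians and integration by parts\<close>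

lemma integrable_translate:
  fixes f :: "'a::euclidean_space \<Rightarrow> 'b::{banach, second_countable_topology}"
  assumes "integrable lborel f"
  shows "integrable lborel (\<lambda>x. f (c + x))" "(LINT x|lborel. f (c + x)) = (LINT x|lborel. f x)"
proof -
  have [measurable]: "f \<in> borel_measurable borel" using assms by auto
  have "integrable (distr lborel borel ((+) c)) f" using assms by (simp add: lborel_distr_plus)
  then show "integrable lborel (\<lambda>x. f (c + x))"
    by (subst (asm) integrable_distr_eq) auto
  have "(LINT x|distr lborel borel ((+) c). f x) = (LINT x|lborel. f (c + x))"
    by (rule integral_distr) auto
  then show "(LINT x|lborel. f (c + x)) = (LINT x|lborel. f x)"
    by (simp add: lborel_distr_plus)
qed

text \<open>The integrand is the product over the coordinates of one-dimensional Gaussians.\<close>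

lemma integrable_gaussian:
  assumes c: "0 < c"
  shows "integrable lborel (\<lambda>x::'a::euclidean_space. exp (- c * (norm x)\<^sup>2))"
proof -
  have one: "(\<integral>\<^sup>+x. ennreal (exp (- c * x\<^sup>2)) \<partial>lborel) < \<infinity>"
  proof -
    define \<sigma> where "\<sigma> = sqrt (1 / (2 * c))"
    have \<sigma>: "0 < \<sigma>" "\<sigma>\<^sup>2 = 1 / (2 * c)" using c by (simp_all add: \<sigma>_def)
    have "integrable lborel (\<lambda>x. sqrt (2 * pi * \<sigma>\<^sup>2) * normal_density 0 \<sigma> x)"
      using \<sigma>(1) by (intro integrable_mult_right integrable_normal_density)
    moreover have "sqrt (2 * pi * \<sigma>\<^sup>2) * normal_density 0 \<sigma> x = exp (- c * x\<^sup>2)" for x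
      using \<sigma> c by (simp add: normal_density_def field_simps)
    ultimately have "integrable lborel (\<lambda>x. exp (- c * x\<^sup>2))" by simp
    then show ?thesis by (simp add: integrable_iff_bounded)
  qed
  have "exp (- c * (norm x)\<^sup>2) = (\<Prod>b\<in>Basis. exp (- c * (x \<bullet> b)\<^sup>2))" for x :: 'a
    unfolding power2_norm_eq_inner
    by (subst euclidean_inner) (simp add: exp_sum sum_distrib_left sum_negf[symmetric] power2_eq_square)
  then have "(\<integral>\<^sup>+x. ennreal (exp (- c * (norm (x::'a))\<^sup>2)) \<partial>lborel)
      = (\<integral>\<^sup>+x. (\<Prod>b\<in>Basis. ennreal (exp (- c * ((x::'a) \<bullet> b)\<^sup>2))) \<partial>lborel)"
    by (simp add: prod_ennreal)
  also have "\<dots> = (\<Prod>b\<in>(Basis::'a set). (\<integral>\<^sup>+x. ennreal (exp (- c * x\<^sup>2)) \<partial>lborel))"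
    by (rule nn_integral_lborel_prod) auto
  also have "\<dots> < \<infinity>" using one by (simp add: power_less_top_ennreal)
  finally show ?thesis by (simp add: integrable_iff_bounded)
qed

lemma integrable_compact_support:
  fixes f :: "'a::euclidean_space \<Rightarrow> 'b::{banach, second_countable_topology}"
  assumes "continuous_on UNIV f" "compact K" "\<And>x. x \<notin> K \<Longrightarrow> f x = 0"
  shows "integrable lborel f"
proof -
  have "integrable lborel (\<lambda>x. indicator K x *\<^sub>R f x)"
    by (rule borel_integrable_compact[OF assms(2) continuous_on_subset[OF assms(1)]]) simp
  moreover have "(\<lambda>x. indicator K x *\<^sub>R f x) = f"
    using assms(3) by (auto simp: fun_eq_iff indicator_def)
  ultimately show ?thesis by simp
qed

lemma square_integrable_compact_support:
  assumes "continuous_on UNIV f" "compact K" "\<And>x. x \<notin> K \<Longrightarrow> f x = 0"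
  shows "square_integrable f"
proof -
  have "f \<in> borel_measurable borel" using assms(1) by (rule borel_measurable_continuous_onI)
  moreover have "integrable lborel (\<lambda>x. (cmod (f x))\<^sup>2)"
    using assms by (intro integrable_compact_support[of _ K] continuous_intros) auto
  ultimately show ?thesis by (simp add: square_integrable_def)
qed

text \<open>A relational counterpart of \<open>partial_deriv\<close>, for which the rules of calculus need no separate
  differentiability hypotheses.\<close>

definition has_dir_derivative :: "'a::euclidean_space \<Rightarrow> ('a \<Rightarrow> complex) \<Rightarrow> ('a \<Rightarrow> complex) \<Rightarrow> bool" where
  "has_dir_derivative b u u' \<longleftrightarrow> (\<forall>x. ((\<lambda>t. u (x + t *\<^sub>R b)) has_vector_derivative u' x) (at 0))"

lemma has_dir_derivative_at:
  assumes "has_dir_derivative b u u'"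
  shows "((\<lambda>t. u (x + t *\<^sub>R b)) has_vector_derivative u' (x + s *\<^sub>R b)) (at s)"
proof -
  have "((\<lambda>t. u ((x + s *\<^sub>R b) + t *\<^sub>R b)) has_vector_derivative u' (x + s *\<^sub>R b)) (at (s - s))"
    using assms by (simp add: has_dir_derivative_def)
  moreover have "((\<lambda>t. t - s) has_vector_derivative 1) (at s)"
    by (auto intro!: derivative_eq_intros)
  ultimately have "((\<lambda>t. u ((x + s *\<^sub>R b) + t *\<^sub>R b)) \<circ> (\<lambda>t. t - s) has_vector_derivative 1 *\<^sub>R u' (x + s *\<^sub>R b)) (at s)"
    by (intro vector_diff_chain_at) simp_all
  then show ?thesis by (simp add: o_def algebra_simps)
qed

text \<open>By translation invariance the integrals of the difference quotients of \<open>g\<close> vanish. They converge to the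
  integral of \<open>g'\<close> by dominated convergence: the mean value inequality bounds the quotients, and
  for steps of size at most \<open>1\<close> their supports stay in one ball.\<close>

lemma integral_dir_derivative_eq_0:
  fixes g :: "'a::euclidean_space \<Rightarrow> complex"
  assumes der: "has_dir_derivative b g g'"
    and cont: "continuous_on UNIV g" "continuous_on UNIV g'"
    and K: "compact K" "\<And>x. x \<notin> K \<Longrightarrow> g x = 0" "\<And>x. x \<notin> K \<Longrightarrow> g' x = 0"
  shows "(LINT x|lborel. g' x) = 0"
proof -
  have [measurable]: "g \<in> borel_measurable borel" "g' \<in> borel_measurable borel"
    using cont by (auto intro: borel_measurable_continuous_onI)
  have int: "integrable lborel g" by (rule integrable_compact_support[OF cont(1) K(1,2)])
  have "bounded (g' ` K)"
    using K(1) cont(2) by (intro compact_imp_bounded compact_continuous_image continuous_on_subset[OF cont(2)]) auto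
  then obtain M where M: "0 < M" "\<And>x. x \<in> K \<Longrightarrow> cmod (g' x) \<le> M"
    by (auto simp: bounded_pos)
  have M': "cmod (g' x) \<le> M" for x
    using M K(3)[of x] by (cases "x \<in> K") auto
  obtain R where R: "\<And>x. x \<in> K \<Longrightarrow> norm x \<le> R"
    using compact_imp_bounded[OF K(1)] by (auto simp: bounded_iff)
  define h where "h n = inverse (real (Suc n))" for n
  have h: "0 < h n" "h n \<le> 1" for n by (auto simp: h_def divide_simps)
  define s where "s n x = (g (x + h n *\<^sub>R b) - g x) / of_real (h n)" for n x
  have mean: "cmod (g (x + t *\<^sub>R b) - g x) \<le> M * \<bar>t\<bar>" for x t
  proof -
    have "norm ((\<lambda>t. g (x + t *\<^sub>R b)) t - (\<lambda>t. g (x + t *\<^sub>R b)) 0) \<le> M * norm (t - 0)"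
    proof (rule differentiable_bound[of UNIV])
      fix s :: real
      show "((\<lambda>t. g (x + t *\<^sub>R b)) has_derivative (\<lambda>r. r *\<^sub>R g' (x + s *\<^sub>R b))) (at s)"
        using has_dir_derivative_at[OF der] by (simp add: has_vector_derivative_def)
      show "onorm (\<lambda>r. r *\<^sub>R g' (x + s *\<^sub>R b)) \<le> M"
        by (rule onorm_le) (simp add: M' mult_left_mono mult.commute[of M])
    qed auto
    then show ?thesis by simp
  qed
  have "(\<lambda>n. LINT x|lborel. s n x) \<longlonglongrightarrow> (LINT x|lborel. g' x)"
  proof (rule integral_dominated_convergence)
    show "integrable lborel (\<lambda>x. M * indicator (cball 0 (R + norm b)) (x::'a))"
      by (intro integrable_mult_right integrable_real_indicator emeasure_bounded_finite) auto
    show "AE x in lborel. (\<lambda>n. s n x) \<longlonglongrightarrow> g' x"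
    proof (rule AE_I2)
      fix x
      have "((\<lambda>t. g (x + t *\<^sub>R b)) has_derivative (\<lambda>t. t *\<^sub>R g' x)) (at 0)"
        using der by (simp add: has_dir_derivative_def has_vector_derivative_def)
      then have "((\<lambda>t. norm (g (x + t *\<^sub>R b) - g x - t *\<^sub>R g' x) / norm t) \<longlongrightarrow> 0) (at 0)"
        by (simp add: has_derivative_at)
      moreover have "filterlim h (at 0) sequentially"
        unfolding filterlim_at using h(1) LIMSEQ_inverse_real_of_nat
        by (auto simp: h_def[abs_def] simp del: of_nat_Suc)
      ultimately have "(\<lambda>n. norm (g (x + h n *\<^sub>R b) - g x - h n *\<^sub>R g' x) / norm (h n)) \<longlonglongrightarrow> 0"
        by (rule filterlim_compose)
      moreover have "norm (g (x + h n *\<^sub>R b) - g x - h n *\<^sub>R g' x) / norm (h n) = norm (s n x - g' x)" for n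
      proof -
        have "s n x - g' x = (g (x + h n *\<^sub>R b) - g x - h n *\<^sub>R g' x) / of_real (h n)"
          using h(1)[of n] by (simp add: s_def scaleR_conv_of_real diff_divide_distrib)
        then show ?thesis by (simp add: norm_divide)
      qed
      ultimately have "(\<lambda>n. norm (s n x - g' x)) \<longlonglongrightarrow> 0" by simp
      then show "(\<lambda>n. s n x) \<longlonglongrightarrow> g' x"
        by (simp add: tendsto_norm_zero_iff LIM_zero_iff)
    qed
    show "AE x in lborel. norm (s n x) \<le> M * indicator (cball 0 (R + norm b)) x" for n
    proof (rule AE_I2)
      fix x :: 'a
      show "norm (s n x) \<le> M * indicator (cball 0 (R + norm b)) x"
      proof (cases "x \<in> cball 0 (R + norm b)")
        case True
        then show ?thesis
          using mean[of x "h n"] h[of n] by (simp add: s_def norm_divide divide_le_eq)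
      next
        case False
        then have far: "R + norm b < norm x" by simp
        then have "x \<notin> K" using R[of x] norm_ge_zero[of b] by linarith
        moreover have "x + h n *\<^sub>R b \<notin> K"
        proof
          assume "x + h n *\<^sub>R b \<in> K"
          then have "norm (x + h n *\<^sub>R b) \<le> R" by (rule R)
          moreover have "norm x \<le> norm (x + h n *\<^sub>R b) + norm (h n *\<^sub>R b)"
            using norm_triangle_ineq4[of "x + h n *\<^sub>R b" "h n *\<^sub>R b"] by simp
          moreover have "norm (h n *\<^sub>R b) \<le> norm b" using h[of n] by (simp add: mult_left_le_one_le)
          ultimately show False using far by linarith
        qed
        ultimately show ?thesis using False by (simp add: s_def K(2))
      qed
    qed
  qed (auto simp: s_def)
  moreover have "(LINT x|lborel. s n x) = 0" for n
  proof -
    have "(LINT x|lborel. s n x) = (LINT x|lborel. g (h n *\<^sub>R b + x) - g x) / of_real (h n)"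
      by (simp add: s_def add.commute)
    also have "\<dots> = 0"
      by (simp add: Bochner_Integration.integral_diff[OF integrable_translate(1)[OF int] int] integrable_translate(2)[OF int])
    finally show ?thesis .
  qed
  ultimately show ?thesis by (simp add: LIMSEQ_const_iff)
qed

lemma integration_by_parts:
  assumes u: "has_dir_derivative b u u'" "continuous_on UNIV u" "continuous_on UNIV u'"
    and v: "has_dir_derivative b v v'" "continuous_on UNIV v" "continuous_on UNIV v'"
    and K: "compact K" "\<And>x. x \<notin> K \<Longrightarrow> u x = 0" "\<And>x. x \<notin> K \<Longrightarrow> u' x = 0"
  shows "(LINT x|lborel. u' x * v x) = - (LINT x|lborel. u x * v' x)"
proof -
  have "has_dir_derivative b (\<lambda>x. u x * v x) (\<lambda>x. u x * v' x + u' x * v x)"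
    using u(1) v(1) unfolding has_dir_derivative_def
    by (auto intro!: has_vector_derivative_eq_rhs[OF has_vector_derivative_mult])
  then have "(LINT x|lborel. u x * v' x + u' x * v x) = 0"
    by (rule integral_dir_derivative_eq_0[OF _ _ _ K(1)]) (auto intro!: continuous_intros u v simp: K)
  moreover have "integrable lborel (\<lambda>x. u x * v' x)" "integrable lborel (\<lambda>x. u' x * v x)"
    by (rule integrable_compact_support[OF _ K(1)]; auto intro!: continuous_intros u v simp: K)+
  ultimately show ?thesis by (simp add: eq_neg_iff_add_eq_0 add.commute)
qed

lemma has_dir_derivative_cnj: "has_dir_derivative b u u' \<Longrightarrow> has_dir_derivative b (\<lambda>x. cnj (u x)) (\<lambda>x. cnj (u' x))"
  unfolding has_dir_derivative_def by (auto intro: has_vector_derivative_cnj)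

lemma has_dir_derivative_support:
  assumes der: "has_dir_derivative b u u'" and K: "closed K" "\<And>x. x \<notin> K \<Longrightarrow> u x = 0" and x: "x \<notin> K"
  shows "u' x = 0"
proof -
  have "open ((\<lambda>t. x + t *\<^sub>R b) -` (- K))"
    using K(1) by (intro open_vimage continuous_intros) auto
  then have "((\<lambda>t. u (x + t *\<^sub>R b)) has_vector_derivative 0) (at 0)"
    by (rule has_vector_derivative_transform_within_open[OF has_vector_derivative_const[of 0]]) (use x K(2) in auto)
  moreover have "((\<lambda>t. u (x + t *\<^sub>R b)) has_vector_derivative u' x) (at 0)"
    using der by (simp add: has_dir_derivative_def)
  ultimately show ?thesis by (rule vector_derivative_unique_at[symmetric])
qed

lemma test_functions_facts:
  assumes \<phi>: "\<phi> \<in> test_functions" and b: "b \<in> Basis"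
  shows "continuous_on UNIV \<phi>" "continuous_on UNIV (partial_deriv b \<phi>)"
    "continuous_on UNIV (partial_deriv b (partial_deriv b \<phi>))"
    "has_dir_derivative b \<phi> (partial_deriv b \<phi>)"
    "has_dir_derivative b (partial_deriv b \<phi>) (partial_deriv b (partial_deriv b \<phi>))"
proof -
  have "C_k (Suc (Suc 0)) \<phi>" using \<phi> unfolding test_functions_def by blast
  then have *: "continuous_on UNIV \<phi>" "continuous_on UNIV (partial_deriv b \<phi>)"
    "continuous_on UNIV (partial_deriv b (partial_deriv b \<phi>))"
    "\<And>x. (\<lambda>t. \<phi> (x + t *\<^sub>R b)) differentiable (at 0)"
    "\<And>x. (\<lambda>t. partial_deriv b \<phi> (x + t *\<^sub>R b)) differentiable (at 0)"
    using b by auto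
  then show "continuous_on UNIV \<phi>" "continuous_on UNIV (partial_deriv b \<phi>)"
    "continuous_on UNIV (partial_deriv b (partial_deriv b \<phi>))" by auto
  show "has_dir_derivative b \<phi> (partial_deriv b \<phi>)"
    "has_dir_derivative b (partial_deriv b \<phi>) (partial_deriv b (partial_deriv b \<phi>))"
    using *(4,5) unfolding has_dir_derivative_def
    by (auto simp: partial_deriv_def[of b \<phi>] partial_deriv_def[of b "partial_deriv b \<phi>"] vector_derivative_works)
qed

section \<open>Coherent states\<close>

text \<open>With the complex vector \<open>w = p + \<i> q\<close>, the functions \<open>phase_dot\<close> and \<open>phase_sq\<close> are the bilinear
  products \<open>w \<cdot> x\<close> and \<open>w \<cdot> w\<close>, without complex conjugation. The phase-space rotation by \<open>t\<close> is multiplication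
  of \<open>w\<close> by \<open>exp (\<i> t)\<close>.\<close>

definition phase_dot :: "'a::euclidean_space \<Rightarrow> 'a \<Rightarrow> 'a \<Rightarrow> complex" where
  "phase_dot p q x = Complex (p \<bullet> x) (q \<bullet> x)"

definition phase_sq :: "'a::euclidean_space \<Rightarrow> 'a \<Rightarrow> complex" where
  "phase_sq p q = Complex ((norm p)\<^sup>2 - (norm q)\<^sup>2) (2 * (p \<bullet> q))"

text \<open>The Gaussian wave packet with position \<open>p\<close> and momentum \<open>q\<close>. In terms of \<open>w = p + \<i> q\<close> it is
  \<open>exp (- \<pi> |x|\<^sup>2 + 2 \<pi> w \<cdot> x - \<pi>/2 w \<cdot> w)\<close>, multiplied by \<open>exp (- \<pi>/2 |w|\<^sup>2)\<close> to make its norm independent of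
  \<open>w\<close>. In this form the flow acts on \<open>w\<close> only, with no further phase besides that of the ground-state energy \<open>d/2\<close>.\<close>

definition coherent :: "'a::euclidean_space \<Rightarrow> 'a \<Rightarrow> 'a \<Rightarrow> complex" where
  "coherent p q x = exp (of_real (- pi * (norm x)\<^sup>2 - pi / 2 * ((norm p)\<^sup>2 + (norm q)\<^sup>2))
     + 2 * of_real pi * phase_dot p q x - of_real pi / 2 * phase_sq p q)"

text \<open>The Hermite expression maps \<open>coherent p q\<close> to \<open>energy p q * coherent p q\<close>.\<close>

definition energy :: "'a::euclidean_space \<Rightarrow> 'a \<Rightarrow> 'a \<Rightarrow> complex" where
  "energy p q x = of_real (real DIM('a) / 2) + 2 * of_real pi * phase_dot p q x - of_real pi * phase_sq p q"

text \<open>The position and the momentum at time \<open>t\<close> of the classical orbit that starts at \<open>(p, q)\<close>.\<close>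

definition rotp :: "real \<Rightarrow> 'a::euclidean_space \<Rightarrow> 'a \<Rightarrow> 'a" where
  "rotp t p q = cos t *\<^sub>R p - sin t *\<^sub>R q"

definition rotq :: "real \<Rightarrow> 'a::euclidean_space \<Rightarrow> 'a \<Rightarrow> 'a" where
  "rotq t p q = sin t *\<^sub>R p + cos t *\<^sub>R q"

lemma phase_dot_rot: "phase_dot (rotp t p q) (rotq t p q) x = cis t * phase_dot p q x"
  by (simp add: complex_eq_iff phase_dot_def rotp_def rotq_def inner_diff_left inner_add_left)

lemma norm_rot: "(norm (rotp t p q))\<^sup>2 + (norm (rotq t p q))\<^sup>2 = (norm p)\<^sup>2 + (norm q)\<^sup>2"
proof -
  have "(norm (c *\<^sub>R p - s *\<^sub>R q))\<^sup>2 + (norm (s *\<^sub>R p + c *\<^sub>R q))\<^sup>2 = (c\<^sup>2 + s\<^sup>2) * ((norm p)\<^sup>2 + (norm q)\<^sup>2)"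
    for c s :: real
    unfolding power2_norm_eq_inner
    by (simp add: inner_diff_left inner_add_left inner_diff_right inner_add_right inner_commute power2_eq_square algebra_simps)
  then show ?thesis by (simp add: rotp_def rotq_def)
qed

lemma phase_sq_sum: "phase_sq p q = (\<Sum>b\<in>Basis. (phase_dot p q b)\<^sup>2)"
  unfolding phase_sq_def phase_dot_def power2_norm_eq_inner
  by (simp add: complex_eq_iff euclidean_inner[of p p] euclidean_inner[of q q] euclidean_inner[of p q]
      sum_subtractf sum_distrib_left power2_eq_square sum.distrib mult_ac)

lemma phase_sq_rot: "phase_sq (rotp t p q) (rotq t p q) = cis (2 * t) * phase_sq p q"
proof -
  have "(cis t)\<^sup>2 = cis (2 * t)" by (simp add: power2_eq_square cis_mult)
  then show ?thesis
    unfolding phase_sq_sum phase_dot_rot power_mult_distrib by (simp add: sum_distrib_left)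
qed

lemma rot_rot: "rotp h (rotp t p q) (rotq t p q) = rotp (t + h) p q"
  "rotq h (rotp t p q) (rotq t p q) = rotq (t + h) p q"
  by (simp_all add: rotp_def rotq_def cos_add sin_add algebra_simps)

text \<open>This is \<open>|w|\<^sup>2 + Re (w \<cdot> w) = 2 |p|\<^sup>2\<close>: the momentum drops out, and the modulus is a Gaussian around \<open>p\<close>.\<close>

lemma norm_coherent: "cmod (coherent p q x) = exp (- pi * (norm (x - p))\<^sup>2)"
proof -
  have "(norm (x - p))\<^sup>2 = (norm x)\<^sup>2 - 2 * (p \<bullet> x) + (norm p)\<^sup>2"
    by (simp add: power2_norm_eq_inner inner_diff_left inner_diff_right inner_commute)
  then show ?thesis
    by (simp add: coherent_def norm_exp_eq_Re phase_dot_def phase_sq_def) (simp add: field_simps)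
qed

lemma continuous_coherent: "continuous_on X (\<lambda>x. coherent p q x)"
  unfolding coherent_def phase_dot_def Complex_eq by (intro continuous_intros)

lemma continuous_energy: "continuous_on X (\<lambda>x. energy p q x)"
  unfolding energy_def phase_dot_def Complex_eq by (intro continuous_intros)

text \<open>The rate \<open>\<pi>/2 - 1\<close> leaves room for polynomial factors and for translations of the centre in
  Gaussians \<open>exp (- \<pi> |x|\<^sup>2)\<close>; it is positive because \<open>\<pi> > 2\<close>.\<close>

lemma square_integrable_gaussian_bound:
  fixes f :: "'a::euclidean_space \<Rightarrow> complex"
  assumes cont: "continuous_on UNIV f" and K: "0 \<le> K"
    and bound: "\<And>x. cmod (f x) \<le> K * exp (- (pi / 2 - 1) * (norm x)\<^sup>2)"
  shows "square_integrable f"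
    and "norm (abs_L2 f) \<le> K * sqrt (LINT x|lborel. exp (- (pi - 2) * (norm (x::'a))\<^sup>2))"
proof -
  have int: "integrable lborel (\<lambda>x::'a. exp (- (pi - 2) * (norm x)\<^sup>2))"
    using pi_gt3 by (intro integrable_gaussian) auto
  have sq: "(cmod (f x))\<^sup>2 \<le> K\<^sup>2 * exp (- (pi - 2) * (norm x)\<^sup>2)" for x
  proof -
    have "(cmod (f x))\<^sup>2 \<le> (K * exp (- (pi / 2 - 1) * (norm x)\<^sup>2))\<^sup>2"
      by (intro power_mono bound) auto
    also have "\<dots> = K\<^sup>2 * exp (- (pi - 2) * (norm x)\<^sup>2)"
      by (simp add: power_mult_distrib exp_double[symmetric] algebra_simps)
    finally show ?thesis .
  qed
  have [measurable]: "f \<in> borel_measurable borel" using cont by (rule borel_measurable_continuous_onI)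
  have int2: "integrable lborel (\<lambda>x. (cmod (f x))\<^sup>2)"
    by (rule Bochner_Integration.integrable_bound[OF integrable_mult_right[OF int, of "K\<^sup>2"]])
       (use sq in \<open>auto intro!: AE_I2\<close>)
  then show f: "square_integrable f" by (simp add: square_integrable_def)
  have "(norm (abs_L2 f))\<^sup>2 \<le> (LINT x|lborel. K\<^sup>2 * exp (- (pi - 2) * (norm (x::'a))\<^sup>2))"
    unfolding norm_abs_sq[OF f] by (intro integral_mono int2 integrable_mult_right int sq)
  also have "\<dots> = (K * sqrt (LINT x|lborel. exp (- (pi - 2) * (norm (x::'a))\<^sup>2)))\<^sup>2"
    by (simp add: power_mult_distrib Bochner_Integration.integral_nonneg)
  finally show "norm (abs_L2 f) \<le> K * sqrt (LINT x|lborel. exp (- (pi - 2) * (norm (x::'a))\<^sup>2))"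
    by (rule power2_le_imp_le) (simp add: K Bochner_Integration.integral_nonneg)
qed

text \<open>The translation costs half of the rate, by \<open>|x|\<^sup>2 \<le> 2 |x - p|\<^sup>2 + 2 \<rho>\<^sup>2\<close>, and the polynomial weight is at
  most \<open>2 exp |x|\<^sup>2\<close>. The bound depends on \<open>p\<close> only through \<open>\<rho>\<close>, hence holds along a whole orbit.\<close>

lemma norm_coherent_weighted:
  fixes x :: "'a::euclidean_space"
  assumes p: "norm p \<le> \<rho>"
  shows "(1 + norm x)\<^sup>2 * cmod (coherent p q x) \<le> 2 * exp (pi * \<rho>\<^sup>2) * exp (- (pi / 2 - 1) * (norm x)\<^sup>2)"
proof -
  have "(1 + norm x)\<^sup>2 \<le> 2 * (1 + (norm x)\<^sup>2)"
    using sum_squares_bound[of 1 "norm x"] by (simp add: power2_sum)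
  also have "\<dots> \<le> 2 * exp ((norm x)\<^sup>2)" by (intro mult_left_mono exp_ge_add_one_self) auto
  finally have 1: "(1 + norm x)\<^sup>2 \<le> 2 * exp ((norm x)\<^sup>2)" .
  have "(norm x)\<^sup>2 \<le> (norm (x - p) + \<rho>)\<^sup>2"
    using norm_triangle_ineq[of "x - p" p] p by (intro power_mono) auto
  also have "\<dots> \<le> 2 * (norm (x - p))\<^sup>2 + 2 * \<rho>\<^sup>2"
    using sum_squares_bound[of "norm (x - p)" \<rho>] by (simp add: power2_sum)
  finally have "pi * ((norm x)\<^sup>2 / 2) \<le> pi * ((norm (x - p))\<^sup>2 + \<rho>\<^sup>2)"
    by (intro mult_left_mono) auto
  then have 2: "cmod (coherent p q x) \<le> exp (pi * \<rho>\<^sup>2 - pi / 2 * (norm x)\<^sup>2)"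
    by (simp add: norm_coherent algebra_simps)
  have "(1 + norm x)\<^sup>2 * cmod (coherent p q x) \<le> 2 * exp ((norm x)\<^sup>2) * exp (pi * \<rho>\<^sup>2 - pi / 2 * (norm x)\<^sup>2)"
    by (intro mult_mono 1 2) auto
  also have "\<dots> = 2 * exp (pi * \<rho>\<^sup>2) * exp (- (pi / 2 - 1) * (norm x)\<^sup>2)"
    by (simp add: mult.assoc exp_add[symmetric] algebra_simps)
  finally show ?thesis .
qed

lemma square_integrable_coherent: "square_integrable (coherent p q)"
proof (rule square_integrable_gaussian_bound(1)[OF continuous_coherent])
  fix x :: 'a
  have "1 * cmod (coherent p q x) \<le> (1 + norm x)\<^sup>2 * cmod (coherent p q x)"
    by (intro mult_right_mono) (auto simp: power2_sum)
  also have "\<dots> \<le> 2 * exp (pi * (norm p)\<^sup>2) * exp (- (pi / 2 - 1) * (norm x)\<^sup>2)"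
    by (rule norm_coherent_weighted) simp
  finally show "cmod (coherent p q x) \<le> 2 * exp (pi * (norm p)\<^sup>2) * exp (- (pi / 2 - 1) * (norm x)\<^sup>2)"
    by simp
qed simp

lemma norm_phase_dot_le: "cmod (phase_dot p q x) \<le> (norm p + norm q) * norm x"
proof -
  have "cmod (phase_dot p q x) \<le> \<bar>p \<bullet> x\<bar> + \<bar>q \<bullet> x\<bar>"
    unfolding phase_dot_def using cmod_le by (metis complex.sel)
  also have "\<dots> \<le> norm p * norm x + norm q * norm x"
    by (intro add_mono Cauchy_Schwarz_ineq2)
  finally show ?thesis by (simp add: algebra_simps)
qed

lemma norm_phase_sq_le: "cmod (phase_sq p q) \<le> (norm p + norm q)\<^sup>2"
proof -
  have "cmod (phase_sq p q) \<le> \<bar>(norm p)\<^sup>2 - (norm q)\<^sup>2\<bar> + \<bar>2 * (p \<bullet> q)\<bar>"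
    unfolding phase_sq_def using cmod_le by (metis complex.sel)
  also have "\<dots> \<le> ((norm p)\<^sup>2 + (norm q)\<^sup>2) + 2 * (norm p * norm q)"
    using Cauchy_Schwarz_ineq2[of p q] by (intro add_mono) (auto simp: abs_le_iff)
  finally show ?thesis by (simp add: power2_sum)
qed

text \<open>A constant for which the first two time derivatives of the exponent of a moving wave packet are at most
  \<open>growth p q * (1 + |x|)\<close>.\<close>

definition growth :: "'a::euclidean_space \<Rightarrow> 'a \<Rightarrow> real" where
  "growth p q = real DIM('a) / 2 + 2 * pi * (norm p + norm q) + 2 * pi * (norm p + norm q)\<^sup>2"

lemma norm_phase_combination_le:
  fixes p q x :: "'a::euclidean_space"
  assumes "cmod u \<le> 1" "cmod v \<le> 1" "cmod c \<le> real DIM('a) / 2"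
  shows "cmod (c + 2 * of_real pi * u * phase_dot p q x + 2 * of_real pi * v * phase_sq p q) \<le> growth p q * (1 + norm x)"
proof -
  let ?r = "norm p + norm q"
  have "cmod (c + 2 * of_real pi * u * phase_dot p q x + 2 * of_real pi * v * phase_sq p q)
      \<le> cmod c + 2 * pi * cmod u * cmod (phase_dot p q x) + 2 * pi * cmod v * cmod (phase_sq p q)"
    by (intro order_trans[OF norm_triangle_ineq] add_mono norm_triangle_ineq) (auto simp: norm_mult)
  also have "\<dots> \<le> real DIM('a) / 2 + 2 * pi * 1 * (?r * norm x) + 2 * pi * 1 * ?r\<^sup>2"
    using assms by (intro add_mono mult_mono norm_phase_dot_le norm_phase_sq_le) auto
  also have "\<dots> \<le> \<dots> + (real DIM('a) / 2 * norm x + 2 * pi * ?r + 2 * pi * ?r\<^sup>2 * norm x)"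
    by (simp add: add_nonneg_nonneg)
  also have "\<dots> = growth p q * (1 + norm x)"
    by (simp add: growth_def field_simps)
  finally show ?thesis .
qed

lemma norm_energy_le: "cmod (energy p q x) \<le> growth p q * (1 + norm x)"
  using norm_phase_combination_le[of 1 "-1/2" "of_real (real DIM('a) / 2)" p q x]
  by (simp add: energy_def norm_divide)

lemma growth_nonneg: "0 \<le> growth p q"
  by (simp add: growth_def)

lemma square_integrable_energy_coherent: "square_integrable (\<lambda>x. energy p q x * coherent p q x)"
proof (rule square_integrable_gaussian_bound(1))
  show "continuous_on UNIV (\<lambda>x. energy p q x * coherent p q x)"
    by (intro continuous_intros continuous_energy continuous_coherent)
  fix x :: 'a
  have "cmod (energy p q x * coherent p q x) \<le> growth p q * (1 + norm x) * cmod (coherent p q x)"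
    unfolding norm_mult by (intro mult_right_mono norm_energy_le) auto
  also have "\<dots> \<le> growth p q * (1 + norm x)\<^sup>2 * cmod (coherent p q x)"
    by (intro mult_right_mono mult_left_mono growth_nonneg) (simp_all add: self_le_power)
  also have "\<dots> = growth p q * ((1 + norm x)\<^sup>2 * cmod (coherent p q x))" by simp
  also have "\<dots> \<le> growth p q * (2 * exp (pi * (norm p)\<^sup>2) * exp (- (pi / 2 - 1) * (norm x)\<^sup>2))"
    by (intro mult_left_mono norm_coherent_weighted growth_nonneg) auto
  finally show "cmod (energy p q x * coherent p q x)
      \<le> growth p q * (2 * exp (pi * (norm p)\<^sup>2)) * exp (- (pi / 2 - 1) * (norm x)\<^sup>2)" by simp
qed (simp add: growth_nonneg)

text \<open>For fixed \<open>x\<close> the moving wave packet is \<open>exp (E t)\<close> with an entire function \<open>E\<close>. The estimate is Taylor's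
  formula of first order, where the second derivative \<open>(E'' + E'\<^sup>2) exp E\<close> is bounded at all real times by a
  Gaussian in \<open>x\<close>. The bound is uniform in \<open>x\<close> up to that Gaussian, so it yields a derivative in \<open>L\<^sup>2\<close>.\<close>

lemma coherent_rot_Taylor:
  fixes p q x :: "'a::euclidean_space" and h :: real
  shows "cmod (cis (h * real DIM('a) / 2) * coherent (rotp h p q) (rotq h p q) x - coherent p q x
      - of_real h * \<i> * energy p q x * coherent p q x)
    \<le> (growth p q + (growth p q)\<^sup>2) * (2 * exp (pi * (norm p + norm q)\<^sup>2)) * h\<^sup>2 * exp (- (pi / 2 - 1) * (norm x)\<^sup>2)"
proof -
  define W where "W = phase_dot p q x"
  define w2 where "w2 = phase_sq p q"
  define d where "d = complex_of_real (real DIM('a) / 2)"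
  define r where "r = complex_of_real (- pi * (norm x)\<^sup>2 - pi / 2 * ((norm p)\<^sup>2 + (norm q)\<^sup>2))"
  define E where "E z = r + \<i> * z * d + 2 * of_real pi * exp (\<i> * z) * W - of_real pi / 2 * exp (2 * \<i> * z) * w2" for z
  define E1 where "E1 z = \<i> * d + 2 * of_real pi * (\<i> * exp (\<i> * z)) * W - of_real pi * (\<i> * exp (2 * \<i> * z)) * w2" for z
  define E2 where "E2 z = - 2 * of_real pi * exp (\<i> * z) * W + 2 * of_real pi * exp (2 * \<i> * z) * w2" for z
  define f where "f n z = (if n = 0 then exp (E z) else if n = 1 then E1 z * exp (E z) else (E2 z + (E1 z)\<^sup>2) * exp (E z))" for n :: nat and z
  define B where "B = (growth p q + (growth p q)\<^sup>2) * (2 * exp (pi * (norm p + norm q)\<^sup>2)) * exp (- (pi / 2 - 1) * (norm x)\<^sup>2)"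
  have E': "(E has_field_derivative E1 z) (at z)" for z
    unfolding E_def E1_def by (auto intro!: derivative_eq_intros simp: algebra_simps)
  have E1': "(E1 has_field_derivative E2 z) (at z)" for z
    unfolding E1_def E2_def by (auto intro!: derivative_eq_intros simp: algebra_simps)
  have expE: "exp (E (of_real t)) = cis (t * real DIM('a) / 2) * coherent (rotp t p q) (rotq t p q) x" for t
    unfolding coherent_def norm_rot phase_dot_rot phase_sq_rot
    by (simp add: E_def r_def W_def w2_def d_def cis_conv_exp exp_add[symmetric] algebra_simps)
  have norm_rotp: "norm (rotp t p q) \<le> norm p + norm q" for t
  proof -
    have "norm (rotp t p q) \<le> \<bar>cos t\<bar> * norm p + \<bar>sin t\<bar> * norm q"
      unfolding rotp_def by (rule order_trans[OF norm_triangle_ineq4]) simp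
    also have "\<dots> \<le> 1 * norm p + 1 * norm q"
      by (intro add_mono mult_right_mono) auto
    finally show ?thesis by simp
  qed
  have "cmod (f 0 (of_real h) - (\<Sum>i\<le>1. f i 0 * (of_real h - 0) ^ i / fact i))
      \<le> B * cmod (of_real h - 0) ^ Suc 1 / fact 1"
  proof (rule field_Taylor[of "range complex_of_real"])
    show "convex (range complex_of_real)"
      by (rule convex_linear_image) (auto intro: bounded_linear.linear bounded_linear_of_real)
    show "(f i has_field_derivative f (Suc i) z) (at z within range complex_of_real)" if "i \<le> 1" for i z
    proof -
      have "i = 0 \<or> i = 1" using that by auto
      then have "(f i has_field_derivative f (Suc i) z) (at z)"
        unfolding f_def
        by (auto intro!: derivative_eq_intros E' E1' simp: power2_eq_square algebra_simps)
      then show ?thesis by (rule has_field_derivative_at_within)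
    qed
    fix z assume "z \<in> range complex_of_real"
    then obtain t where z: "z = of_real t" by auto
    have u: "cmod (exp (\<i> * z)) = 1" "cmod (exp (2 * \<i> * z)) = 1" by (simp_all add: z norm_exp_eq_Re)
    have b1: "cmod (E1 z) \<le> growth p q * (1 + norm x)"
      using norm_phase_combination_le[of "\<i> * exp (\<i> * z)" "- \<i> * exp (2 * \<i> * z) / 2" "\<i> * d" p q x] u
      by (simp add: E1_def d_def norm_mult norm_divide W_def w2_def)
    have b2: "cmod (E2 z) \<le> growth p q * (1 + norm x)"
      using norm_phase_combination_le[of "- exp (\<i> * z)" "exp (2 * \<i> * z)" "0" p q x] u
      by (simp add: E2_def W_def w2_def)
    have "cmod (E2 z + (E1 z)\<^sup>2) \<le> growth p q * (1 + norm x) + (growth p q * (1 + norm x))\<^sup>2"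
      by (intro order_trans[OF norm_triangle_ineq] add_mono b2) (auto simp: norm_power intro!: power_mono b1)
    also have "\<dots> \<le> growth p q * (1 + norm x)\<^sup>2 + (growth p q * (1 + norm x))\<^sup>2"
      by (intro add_mono mult_left_mono growth_nonneg) (simp_all add: self_le_power)
    also have "\<dots> = (growth p q + (growth p q)\<^sup>2) * (1 + norm x)\<^sup>2"
      by (simp only: power_mult_distrib distrib_right)
    finally have b: "cmod (E2 z + (E1 z)\<^sup>2) \<le> (growth p q + (growth p q)\<^sup>2) * (1 + norm x)\<^sup>2" .
    have "cmod (f (Suc 1) z) = cmod (E2 z + (E1 z)\<^sup>2) * cmod (coherent (rotp t p q) (rotq t p q) x)"
      by (simp add: f_def norm_mult z expE)
    also have "\<dots> \<le> (growth p q + (growth p q)\<^sup>2) * (1 + norm x)\<^sup>2 * cmod (coherent (rotp t p q) (rotq t p q) x)"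
      by (intro mult_right_mono b) auto
    also have "\<dots> \<le> (growth p q + (growth p q)\<^sup>2) * (2 * exp (pi * (norm p + norm q)\<^sup>2) * exp (- (pi / 2 - 1) * (norm x)\<^sup>2))"
      unfolding mult.assoc[of _ "(1 + norm x)\<^sup>2"]
      by (intro mult_left_mono norm_coherent_weighted norm_rotp) (simp add: growth_nonneg)
    also have "\<dots> = B" by (simp add: B_def)
    finally show "cmod (f (Suc 1) z) \<le> B" .
  qed (auto intro: range_eqI[of _ _ 0])
  moreover have "f 0 (of_real h) = cis (h * real DIM('a) / 2) * coherent (rotp h p q) (rotq h p q) x"
    by (simp add: f_def expE)
  moreover have "exp (E 0) = coherent p q x" using expE[of 0] by (simp add: rotp_def rotq_def)
  moreover have "E1 0 = \<i> * energy p q x"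
    by (simp add: E1_def energy_def d_def W_def w2_def algebra_simps)
  ultimately show ?thesis
    by (simp add: f_def B_def algebra_simps power2_eq_square)
qed

section \<open>Evolution of coherent states\<close>

lemma has_dir_derivative_coherent:
  assumes b: "b \<in> Basis"
  shows "has_dir_derivative b (coherent p q)
    (\<lambda>x. 2 * of_real pi * (phase_dot p q b - of_real (x \<bullet> b)) * coherent p q x)"
  unfolding has_dir_derivative_def
proof
  fix x
  define c where "c = of_real (- pi * (norm x)\<^sup>2 - pi / 2 * ((norm p)\<^sup>2 + (norm q)\<^sup>2))
     + 2 * of_real pi * phase_dot p q x - of_real pi / 2 * phase_sq p q"
  have line: "coherent p q (x + t *\<^sub>R b)
      = exp (c + of_real t * (2 * of_real pi * (phase_dot p q b - of_real (x \<bullet> b))) - of_real pi * (of_real t)\<^sup>2)" for t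
  proof -
    have n: "(norm (x + t *\<^sub>R b))\<^sup>2 = (norm x)\<^sup>2 + 2 * t * (x \<bullet> b) + t\<^sup>2"
      unfolding power2_norm_eq_inner
      using b by (simp add: inner_add_left inner_add_right inner_commute power2_eq_square algebra_simps)
    have d: "phase_dot p q (x + t *\<^sub>R b) = phase_dot p q x + of_real t * phase_dot p q b"
      by (simp add: phase_dot_def complex_eq_iff inner_add_right)
    show ?thesis unfolding coherent_def n d c_def by (simp add: algebra_simps)
  qed
  have "((\<lambda>z. exp (c + z * (2 * of_real pi * (phase_dot p q b - of_real (x \<bullet> b))) - of_real pi * z\<^sup>2))
      has_field_derivative 2 * of_real pi * (phase_dot p q b - of_real (x \<bullet> b)) * exp c) (at (of_real 0))"
    by (auto intro!: derivative_eq_intros)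
  from has_vector_derivative_real_field[OF this]
  show "((\<lambda>t. coherent p q (x + t *\<^sub>R b)) has_vector_derivative
      2 * of_real pi * (phase_dot p q b - of_real (x \<bullet> b)) * coherent p q x) (at 0)"
    using line[of 0] by (simp add: line)
qed

lemma has_dir_derivative_coherent2:
  assumes b: "b \<in> Basis"
  shows "has_dir_derivative b
    (\<lambda>x. 2 * of_real pi * (phase_dot p q b - of_real (x \<bullet> b)) * coherent p q x)
    (\<lambda>x. (4 * (of_real pi)\<^sup>2 * (phase_dot p q b - of_real (x \<bullet> b))\<^sup>2 - 2 * of_real pi) * coherent p q x)"
  unfolding has_dir_derivative_def
proof
  fix x
  have "((\<lambda>t. 2 * of_real pi * (phase_dot p q b - of_real ((x + t *\<^sub>R b) \<bullet> b))) has_vector_derivative - 2 * of_real pi) (at 0)"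
  proof -
    have "(\<lambda>t. 2 * of_real pi * (phase_dot p q b - of_real ((x + t *\<^sub>R b) \<bullet> b)))
        = (\<lambda>t. 2 * of_real pi * (phase_dot p q b - of_real (x \<bullet> b)) + t *\<^sub>R (- 2 * of_real pi))"
      using b by (simp add: fun_eq_iff inner_add_left scaleR_conv_of_real algebra_simps)
    then show ?thesis by (auto intro!: derivative_eq_intros)
  qed
  from has_vector_derivative_mult[OF this has_dir_derivative_coherent[OF b, unfolded has_dir_derivative_def, rule_format, of p q x]]
  show "((\<lambda>t. 2 * of_real pi * (phase_dot p q b - of_real ((x + t *\<^sub>R b) \<bullet> b)) * coherent p q (x + t *\<^sub>R b)) has_vector_derivative
      (4 * (of_real pi)\<^sup>2 * (phase_dot p q b - of_real (x \<bullet> b))\<^sup>2 - 2 * of_real pi) * coherent p q x) (at 0)"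
    by (simp add: power2_eq_square algebra_simps)
qed

lemma sum_second_derivative_coefficient:
  fixes p q x :: "'a::euclidean_space"
  shows "(\<Sum>b\<in>Basis. (4 * (of_real pi)\<^sup>2 * (phase_dot p q b - of_real (x \<bullet> b))\<^sup>2 - 2 * of_real pi))
    = - 4 * of_real pi * (energy p q x - of_real (pi * (norm x)\<^sup>2))"
proof -
  have x2: "(\<Sum>b\<in>Basis. (complex_of_real (x \<bullet> b))\<^sup>2) = of_real ((norm x)\<^sup>2)"
    unfolding power2_norm_eq_inner by (simp add: euclidean_inner[of x x] power2_eq_square)
  have wx: "(\<Sum>b\<in>Basis. phase_dot p q b * complex_of_real (x \<bullet> b)) = phase_dot p q x"
    by (simp add: complex_eq_iff phase_dot_def euclidean_inner[of p x] euclidean_inner[of q x])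
  have S: "(\<Sum>b\<in>Basis. (phase_dot p q b - of_real (x \<bullet> b))\<^sup>2)
      = phase_sq p q - 2 * phase_dot p q x + of_real ((norm x)\<^sup>2)"
    unfolding power2_diff sum.distrib sum_subtractf phase_sq_sum x2[symmetric] wx[symmetric]
    by (simp add: sum_distrib_left mult.assoc)
  show ?thesis
    unfolding sum_subtractf sum_distrib_left[symmetric] S sum_constant energy_def
    by (simp add: power2_eq_square algebra_simps)
qed

text \<open>Integration by parts moves the two derivatives of the expression from the test function to the wave
  packet, where the expression reduces to multiplication by \<open>energy\<close>
  (\<open>sum_second_derivative_coefficient\<close>).\<close>

lemma coherent_in_hermite_op:
  "(abs_L2 (coherent p q), abs_L2 (\<lambda>x. energy p q x * coherent p q x)) \<in> hermite_op"
  unfolding hermite_op_def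
proof (clarify)
  fix \<phi> :: "'a \<Rightarrow> complex"
  assume \<phi>: "\<phi> \<in> test_functions"
  then obtain K where K: "compact K" "\<And>x. x \<notin> K \<Longrightarrow> \<phi> x = 0"
    by (auto simp: test_functions_def)
  define D where "D b = partial_deriv b \<phi>" for b
  define DD where "DD b = partial_deriv b (D b)" for b
  note facts = test_functions_facts[OF \<phi>, folded D_def, folded DD_def]
  obtain b0 :: 'a where b0: "b0 \<in> Basis" by (rule nonempty_Basis[THEN ex_in_conv[THEN iffD2], THEN exE])
  have cont: "continuous_on UNIV \<phi>" using facts(1)[OF b0] .
  have D0: "D b x = 0" if "b \<in> Basis" "x \<notin> K" for b x
    using has_dir_derivative_support[OF facts(4) compact_imp_closed[OF K(1)] K(2)] that by blast
  have DD0: "DD b x = 0" if "b \<in> Basis" "x \<notin> K" for b x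
    using has_dir_derivative_support[OF facts(5) compact_imp_closed[OF K(1)] D0] that by blast
  have H: "hermite_expr \<phi> x = - (1 / (4 * of_real pi)) * (\<Sum>b\<in>Basis. DD b x) + of_real (pi * (norm x)\<^sup>2) * \<phi> x" for x
    by (simp add: hermite_expr_def laplacian_def DD_def D_def)
  have sqH: "square_integrable (hermite_expr \<phi>)"
    unfolding H[abs_def]
    by (rule square_integrable_compact_support[OF _ K(1)]) (auto intro!: continuous_intros facts(3) cont simp: K(2) DD0)
  have sq\<phi>: "square_integrable \<phi>"
    by (rule square_integrable_compact_support[OF cont K])
  let ?c = "coherent p q"
  define m where "m b x = 2 * of_real pi * (phase_dot p q b - of_real (x \<bullet> b)) * ?c x" for b x
  define m2 where "m2 b x = (4 * (of_real pi)\<^sup>2 * (phase_dot p q b - of_real (x \<bullet> b))\<^sup>2 - 2 * of_real pi) * ?c x" for b x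
  have cm: "continuous_on UNIV (m b)" "continuous_on UNIV (m2 b)" for b
    unfolding m_def m2_def by (intro continuous_intros continuous_coherent)+
  have dm: "has_dir_derivative b ?c (m b)" "has_dir_derivative b (m b) (m2 b)" if "b \<in> Basis" for b
    using has_dir_derivative_coherent[OF that] has_dir_derivative_coherent2[OF that]
    by (simp_all add: m_def[abs_def] m2_def[abs_def])
  have ibp: "(LINT x|lborel. cnj (DD b x) * ?c x) = (LINT x|lborel. cnj (\<phi> x) * m2 b x)" if b: "b \<in> Basis" for b
  proof -
    have "(LINT x|lborel. cnj (DD b x) * ?c x) = - (LINT x|lborel. cnj (D b x) * m b x)"
      by (rule integration_by_parts[OF has_dir_derivative_cnj[OF facts(5)[OF b]] _ _
            dm(1)[OF b] continuous_coherent cm(1) K(1)])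
         (auto intro!: continuous_intros facts b simp: D0[OF b] DD0[OF b])
    also have "(LINT x|lborel. cnj (D b x) * m b x) = - (LINT x|lborel. cnj (\<phi> x) * m2 b x)"
      by (rule integration_by_parts[OF has_dir_derivative_cnj[OF facts(4)[OF b]] _ _
            dm(2)[OF b] cm K(1)])
         (auto intro!: continuous_intros facts b simp: D0[OF b] K(2))
    finally show ?thesis by simp
  qed
  have int1: "integrable lborel (\<lambda>x. cnj (DD b x) * ?c x)" if "b \<in> Basis" for b
    by (rule integrable_compact_support[OF _ K(1)]) (auto intro!: continuous_intros continuous_coherent facts that simp: DD0 that)
  have int2: "integrable lborel (\<lambda>x. cnj (\<phi> x) * m2 b x)" for b
    by (rule integrable_compact_support[OF _ K(1)]) (auto intro!: continuous_intros cont cm simp: K(2))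
  have int3: "integrable lborel (\<lambda>x. of_real (pi * (norm x)\<^sup>2) * (cnj (\<phi> x) * ?c x))"
    by (rule integrable_compact_support[OF _ K(1)]) (auto intro!: continuous_intros cont continuous_coherent simp: K(2))
  define k :: complex where "k = - (1 / (4 * of_real pi))"
  have "cinner (abs_L2 (hermite_expr \<phi>)) (abs_L2 ?c) = (LINT x|lborel. cnj (hermite_expr \<phi> x) * ?c x)"
    by (rule cinner_abs[OF sqH square_integrable_coherent])
  also have "\<dots> = (LINT x|lborel. k * (\<Sum>b\<in>Basis. cnj (DD b x) * ?c x) + of_real (pi * (norm x)\<^sup>2) * (cnj (\<phi> x) * ?c x))"
    by (intro Bochner_Integration.integral_cong refl) (simp add: H k_def sum_distrib_right[symmetric] algebra_simps)
  also have "\<dots> = k * (\<Sum>b\<in>Basis. LINT x|lborel. cnj (DD b x) * ?c x) + (LINT x|lborel. of_real (pi * (norm x)\<^sup>2) * (cnj (\<phi> x) * ?c x))"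
    using int1 int3 by (simp add: Bochner_Integration.integral_add Bochner_Integration.integral_sum)
  also have "\<dots> = k * (\<Sum>b\<in>Basis. LINT x|lborel. cnj (\<phi> x) * m2 b x) + (LINT x|lborel. of_real (pi * (norm x)\<^sup>2) * (cnj (\<phi> x) * ?c x))"
    using ibp by simp
  also have "\<dots> = (LINT x|lborel. k * (\<Sum>b\<in>Basis. cnj (\<phi> x) * m2 b x) + of_real (pi * (norm x)\<^sup>2) * (cnj (\<phi> x) * ?c x))"
    using int2 int3 by (simp add: Bochner_Integration.integral_add Bochner_Integration.integral_sum)
  also have "\<dots> = (LINT x|lborel. cnj (\<phi> x) * (energy p q x * ?c x))"
  proof (intro Bochner_Integration.integral_cong refl)
    fix x
    have S: "(\<Sum>b\<in>Basis. cnj (\<phi> x) * m2 b x) = cnj (\<phi> x) * ?c x * (- 4 * of_real pi * (energy p q x - of_real (pi * (norm x)\<^sup>2)))"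
      unfolding sum_second_derivative_coefficient[symmetric] sum_distrib_left m2_def
      by (intro sum.cong refl) (simp add: mult_ac)
    show "k * (\<Sum>b\<in>Basis. cnj (\<phi> x) * m2 b x) + of_real (pi * (norm x)\<^sup>2) * (cnj (\<phi> x) * ?c x)
        = cnj (\<phi> x) * (energy p q x * ?c x)"
      unfolding S k_def by (simp add: field_simps)
  qed
  also have "\<dots> = cinner (abs_L2 \<phi>) (abs_L2 (\<lambda>x. energy p q x * ?c x))"
    by (rule cinner_abs[OF sq\<phi> square_integrable_energy_coherent, symmetric])
  finally show "cinner (abs_L2 (hermite_expr \<phi>)) (abs_L2 ?c) = cinner (abs_L2 \<phi>) (abs_L2 (\<lambda>x. energy p q x * ?c x))" .
qed

definition coherent_state :: "'a::euclidean_space \<Rightarrow> 'a \<Rightarrow> 'a L2" where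
  "coherent_state p q = abs_L2 (coherent p q)"

text \<open>The solution of the evolution equation that starts at \<open>coherent_state p q\<close>; the phase comes from the
  ground-state energy.\<close>

definition coherent_orbit :: "'a::euclidean_space \<Rightarrow> 'a \<Rightarrow> real \<Rightarrow> 'a L2" where
  "coherent_orbit p q t = scaleC (cis (t * real DIM('a) / 2)) (coherent_state (rotp t p q) (rotq t p q))"

text \<open>Because of this property the derivative of an orbit is only needed at time \<open>0\<close>.\<close>

lemma coherent_orbit_add:
  fixes p q :: "'a::euclidean_space"
  shows "coherent_orbit p q (t + h) = scaleC (cis (t * real DIM('a) / 2)) (coherent_orbit (rotp t p q) (rotq t p q) h)"
  by (simp add: coherent_orbit_def scaleC_scaleC rot_rot cis_mult algebra_simps add_divide_distrib)

lemma coherent_orbit_0: "coherent_orbit p q 0 = coherent_state p q"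
  by (simp add: coherent_orbit_def rotp_def rotq_def)

lemma coherent_orbit_derivative:
  fixes p q :: "'a::euclidean_space"
  shows "((\<lambda>t. coherent_orbit p q t) has_vector_derivative
    scaleC \<i> (abs_L2 (\<lambda>x. energy p q x * coherent p q x))) (at 0)"
proof -
  let ?g = "abs_L2 (\<lambda>x. energy p q x * coherent p q x)"
  define C where "C = (growth p q + (growth p q)\<^sup>2) * (2 * exp (pi * (norm p + norm q)\<^sup>2))
      * sqrt (LINT x|lborel. exp (- (pi - 2) * (norm (x::'a))\<^sup>2))"
  have bound: "norm (coherent_orbit p q h - coherent_orbit p q 0 - h *\<^sub>R scaleC \<i> ?g) \<le> C * h\<^sup>2" for h
  proof -
    let ?f = "\<lambda>x. cis (h * real DIM('a) / 2) * coherent (rotp h p q) (rotq h p q) x - coherent p q x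
      - of_real h * \<i> * energy p q x * coherent p q x"
    have eq: "coherent_orbit p q h - coherent_orbit p q 0 - h *\<^sub>R scaleC \<i> ?g = abs_L2 ?f"
      unfolding coherent_orbit_0 unfolding coherent_orbit_def coherent_state_def scaleR_L2_def scaleC_scaleC
      by (simp add: scaleC_abs minus_abs square_integrable_coherent square_integrable_energy_coherent
          square_integrable_cmult square_integrable_diff mult.assoc)
    have "norm (abs_L2 ?f) \<le> (growth p q + (growth p q)\<^sup>2) * (2 * exp (pi * (norm p + norm q)\<^sup>2)) * h\<^sup>2
        * sqrt (LINT x|lborel. exp (- (pi - 2) * (norm (x::'a))\<^sup>2))"
      by (rule square_integrable_gaussian_bound(2)[OF _ _ coherent_rot_Taylor])
         (auto intro!: continuous_intros continuous_coherent continuous_energy simp: growth_nonneg)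
    then show ?thesis unfolding eq C_def by (simp add: mult_ac)
  qed
  have lim: "((\<lambda>h::real. C * \<bar>h\<bar>) \<longlongrightarrow> 0) (at 0)"
    by (auto intro!: tendsto_eq_intros)
  have "((\<lambda>h. norm (coherent_orbit p q (0 + h) - coherent_orbit p q 0 - h *\<^sub>R scaleC \<i> ?g) / norm h) \<longlongrightarrow> 0) (at 0)"
  proof (rule Lim_null_comparison[OF _ lim])
    show "\<forall>\<^sub>F h in at 0. norm (norm (coherent_orbit p q (0 + h) - coherent_orbit p q 0 - h *\<^sub>R scaleC \<i> ?g) / norm h) \<le> C * \<bar>h\<bar>"
      unfolding eventually_at_filter
      using bound by (intro always_eventually) (auto simp: divide_le_eq power2_eq_square abs_mult_self_eq mult.assoc)
  qed
  then show ?thesis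
    unfolding has_vector_derivative_def has_derivative_at by (simp add: bounded_linear_scaleR_left)
qed

lemma norm_coherent_state_sq:
  fixes p q :: "'a::euclidean_space"
  shows "(norm (coherent_state p q))\<^sup>2 = (LINT x|lborel. exp (- 2 * pi * (norm (x::'a))\<^sup>2))"
proof -
  have "(norm (coherent_state p q))\<^sup>2 = (LINT x|lborel. exp (- 2 * pi * (norm (- p + x))\<^sup>2))"
    unfolding coherent_state_def norm_abs_sq[OF square_integrable_coherent] norm_coherent
    by (simp add: exp_double[symmetric] add.commute mult.assoc flip: exp_double)
  also have "\<dots> = (LINT x|lborel. exp (- 2 * pi * (norm (x::'a))\<^sup>2))"
    using integrable_translate(2)[of "\<lambda>x::'a. exp (- 2 * pi * (norm x)\<^sup>2)" "- p"] integrable_gaussian[of "2 * pi"]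
    by simp
  finally show ?thesis .
qed

context hermite_group
begin

text \<open>For \<open>Y t = U (- t) (coherent_orbit p q t)\<close> the increment from \<open>t\<close> to \<open>t + h\<close> has the same norm as the
  difference of \<open>coherent_orbit p' q' h\<close> and \<open>U h (coherent_state p' q')\<close>, where \<open>(p', q')\<close> is the rotated
  point. Both have the same derivative at \<open>h = 0\<close>: the former by Taylor's formula, the latter because
  the wave packet lies in the domain of the generator. So \<open>Y\<close> has derivative zero and is constant.\<close>

lemma U_coherent_state: "U t (coherent_state p q) = coherent_orbit p q t"
proof -
  define Y where "Y t = U (- t) (coherent_orbit p q t)" for t
  have Y': "(Y has_derivative (\<lambda>_. 0)) (at t)" for t
  proof -
    define p' q' where "p' = rotp t p q" and "q' = rotq t p q"
    let ?g = "abs_L2 (\<lambda>x. energy p' q' x * coherent p' q' x)"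
    define E where "E h = coherent_orbit p' q' h - U h (coherent_state p' q')" for h
    have "((\<lambda>t. U t (coherent_state p' q')) has_vector_derivative scaleC \<i> ?g) (at 0)"
      using coherent_in_hermite_op[of p' q'] unfolding generator coherent_state_def .
    from has_vector_derivative_diff[OF coherent_orbit_derivative[of p' q'] this]
    have "(E has_derivative (\<lambda>_. 0)) (at 0)"
      by (simp add: E_def[abs_def] has_vector_derivative_def)
    then have lim: "((\<lambda>h. norm (E h) / norm h) \<longlongrightarrow> 0) (at 0)"
      unfolding has_derivative_at by (simp add: E_def coherent_orbit_0)
    have "Y (t + h) - Y t = U (- (t + h)) (scaleC (cis (t * real DIM('a) / 2)) (E h))" for h
    proof -
      have "Y t = U (- (t + h)) (U h (coherent_orbit p q t))"
        by (simp add: Y_def U_U)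
      then have "Y (t + h) - Y t = U (- (t + h)) (coherent_orbit p q (t + h) - U h (coherent_orbit p q t))"
        unfolding Y_def by (simp add: U_diff)
      also have "coherent_orbit p q (t + h) - U h (coherent_orbit p q t) = scaleC (cis (t * real DIM('a) / 2)) (E h)"
      proof -
        have "scaleC c (f - g) = scaleC c f - scaleC c g" for c and f g :: "'a L2"
          using scaleC_add_right[of c "f - g" g] by (simp add: eq_diff_eq)
        then show ?thesis
          unfolding coherent_orbit_add E_def p'_def q'_def by (simp add: coherent_orbit_def U_scaleC)
      qed
      finally show ?thesis .
    qed
    then have "norm (Y (t + h) - Y t) = norm (E h)" for h
      by (simp add: norm_scaleC)
    then show ?thesis using lim by (simp add: has_derivative_at)
  qed
  have "\<exists>c. \<forall>t\<in>UNIV. Y t = c"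
    by (rule has_derivative_zero_constant) (auto intro: Y')
  then have "Y t = Y 0" by auto
  then have "U t (Y t) = U t (coherent_state p q)" by (simp add: Y_def coherent_orbit_0)
  then show ?thesis by (simp add: Y_def U_U)
qed

end

section \<open>A lattice of coherent states\<close>

definition gauss_mass :: "'a::euclidean_space itself \<Rightarrow> real" where
  "gauss_mass _ = (LINT x|lborel. exp (- 2 * pi * (norm (x::'a))\<^sup>2))"

lemma gauss_mass_nonneg: "0 \<le> gauss_mass TYPE('a::euclidean_space)"
  unfolding gauss_mass_def by (intro Bochner_Integration.integral_nonneg) simp

text \<open>The moduli are Gaussians around \<open>p\<close> and \<open>p'\<close>. By the parallelogram identity their product is a Gaussian around
  the midpoint, times a factor that decays in the distance of \<open>p\<close> and \<open>p'\<close>.\<close>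

lemma coherent_overlap_position:
  fixes p q p' q' :: "'a::euclidean_space"
  shows "cmod (cinner (coherent_state p q) (coherent_state p' q')) \<le> gauss_mass TYPE('a) * exp (- pi / 2 * (norm (p - p'))\<^sup>2)"
proof -
  define m where "m = (1/2) *\<^sub>R (p + p')"
  have par: "(norm (x - p))\<^sup>2 + (norm (x - p'))\<^sup>2 = 2 * (norm (- m + x))\<^sup>2 + (norm (p - p'))\<^sup>2 / 2" for x
    unfolding power2_norm_eq_inner m_def
    by (simp add: inner_add_left inner_add_right inner_diff_left inner_diff_right inner_commute field_simps)
  have "cmod (cinner (coherent_state p q) (coherent_state p' q'))
      \<le> (LINT x|lborel. cmod (cnj (coherent p q x) * coherent p' q' x))"
    unfolding coherent_state_def cinner_abs[OF square_integrable_coherent square_integrable_coherent]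
    by (rule integral_norm_bound)
  also have "\<dots> = (LINT x|lborel. exp (- pi / 2 * (norm (p - p'))\<^sup>2) * exp (- 2 * pi * (norm (- m + x))\<^sup>2))"
  proof (intro Bochner_Integration.integral_cong refl)
    fix x
    have "cmod (cnj (coherent p q x) * coherent p' q' x) = exp (- pi * ((norm (x - p))\<^sup>2 + (norm (x - p'))\<^sup>2))"
      by (simp add: norm_mult norm_coherent exp_add[symmetric] algebra_simps)
    also have "\<dots> = exp (- pi / 2 * (norm (p - p'))\<^sup>2) * exp (- 2 * pi * (norm (- m + x))\<^sup>2)"
      unfolding par exp_add[symmetric] by (simp add: field_simps)
    finally show "cmod (cnj (coherent p q x) * coherent p' q' x)
        = exp (- pi / 2 * (norm (p - p'))\<^sup>2) * exp (- 2 * pi * (norm (- m + x))\<^sup>2)" .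
  qed
  also have "\<dots> = exp (- pi / 2 * (norm (p - p'))\<^sup>2) * (LINT x|lborel. exp (- 2 * pi * (norm (- m + x))\<^sup>2))"
    by simp
  also have "(LINT x|lborel. exp (- 2 * pi * (norm (- m + x))\<^sup>2)) = gauss_mass TYPE('a)"
    using integrable_translate(2)[of "\<lambda>x::'a. exp (- 2 * pi * (norm x)\<^sup>2)" "- m"] integrable_gaussian[of "2 * pi"]
    by (simp add: gauss_mass_def)
  finally show ?thesis by (simp add: mult.commute)
qed

context hermite_group
begin

text \<open>Decay in the momenta follows from decay in the positions: the unitary
  \<open>U (\<pi>/2)\<close> preserves inner products and rotates phase space by a right angle, which turns momenta into
  positions. The geometric mean of the two bounds gives the product.\<close>

lemma coherent_overlap:
  fixes p q p' q' :: 'a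
  shows "cmod (cinner (coherent_state p q) (coherent_state p' q'))
    \<le> gauss_mass TYPE('a) * (exp (- pi / 4 * (norm (p - p'))\<^sup>2) * exp (- pi / 4 * (norm (q - q'))\<^sup>2))"
proof -
  let ?G = "cmod (cinner (coherent_state p q) (coherent_state p' q'))"
  have "cinner (coherent_state p q) (coherent_state p' q')
      = cinner (U (pi / 2) (coherent_state p q)) (U (pi / 2) (coherent_state p' q'))"
    by (simp add: cinner_U)
  also have "cmod \<dots> = cmod (cinner (coherent_state (- q) p) (coherent_state (- q') p'))"
    unfolding U_coherent_state coherent_orbit_def rotp_def rotq_def
    by (simp add: cinner_scaleC_left cinner_scaleC_right norm_mult)
  also have "\<dots> \<le> gauss_mass TYPE('a) * exp (- pi / 2 * (norm (- q - - q'))\<^sup>2)"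
    by (rule coherent_overlap_position)
  finally have Gq: "?G \<le> gauss_mass TYPE('a) * exp (- pi / 2 * (norm (q - q'))\<^sup>2)"
    by (simp add: norm_minus_commute)
  have Gp: "?G \<le> gauss_mass TYPE('a) * exp (- pi / 2 * (norm (p - p'))\<^sup>2)"
    by (rule coherent_overlap_position)
  have half: "exp (- pi / 2 * r) = (exp (- pi / 4 * r))\<^sup>2" for r
    by (simp flip: exp_double)
  have "?G\<^sup>2 \<le> (gauss_mass TYPE('a) * exp (- pi / 2 * (norm (p - p'))\<^sup>2)) * (gauss_mass TYPE('a) * exp (- pi / 2 * (norm (q - q'))\<^sup>2))"
    unfolding power2_eq_square[of ?G] by (intro mult_mono Gp Gq) (auto simp: gauss_mass_nonneg)
  also have "\<dots> = (gauss_mass TYPE('a) * (exp (- pi / 4 * (norm (p - p'))\<^sup>2) * exp (- pi / 4 * (norm (q - q'))\<^sup>2)))\<^sup>2"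
    unfolding half by (simp only: power_mult_distrib) (simp only: power2_eq_square mult_ac)
  finally show ?thesis
    by (rule power2_le_imp_le) (simp add: gauss_mass_nonneg)
qed

text \<open>If the centre is in the unit ball, then all points of the ball of radius \<open>2\<close> are within distance \<open>3\<close> of it,
  and there the density is at least \<open>exp (- 2 \<pi> 3\<^sup>2)\<close>.\<close>

lemma coherent_mass_in_ball:
  assumes "norm (rotp t p q) \<le> 1"
  shows "exp (- 18 * pi) * measure lborel (cball (0::'a) 2)
    \<le> Re (cinner (U t (coherent_state p q)) (restrict_op (cball 0 2) (U t (coherent_state p q))))"
proof -
  define u where "u x = cis (t * real DIM('a) / 2) * coherent (rotp t p q) (rotq t p q) x" for x
  have u: "square_integrable u"
    unfolding u_def by (intro square_integrable_cmult square_integrable_coherent)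
  have Uu: "U t (coherent_state p q) = abs_L2 u"
    unfolding U_coherent_state coherent_orbit_def unfolding coherent_state_def u_def
    by (rule scaleC_abs[OF square_integrable_coherent])
  have fin: "emeasure lborel (cball (0::'a) 2) < \<infinity>" by (intro emeasure_bounded_finite) auto
  have "exp (- 18 * pi) * measure lborel (cball (0::'a) 2) = (LINT x|lborel. exp (- 18 * pi) * indicator (cball (0::'a) 2) x)"
    by simp
  also have "\<dots> \<le> (LINT x|lborel. indicator (cball 0 2) x * (cmod (u x))\<^sup>2)"
  proof (rule integral_mono)
    show "integrable lborel (\<lambda>x. exp (- 18 * pi) * indicator (cball (0::'a) 2) x)"
      using fin by (intro integrable_mult_right integrable_real_indicator) auto
    show "integrable lborel (\<lambda>x. indicator (cball 0 2) x * (cmod (u x))\<^sup>2)"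
      using integrable_real_mult_indicator[of "cball 0 2" lborel "\<lambda>x. (cmod (u x))\<^sup>2"] u
      by (simp add: square_integrable_def mult.commute)
    fix x :: 'a
    show "exp (- 18 * pi) * indicator (cball 0 2) x \<le> indicator (cball 0 2) x * (cmod (u x))\<^sup>2"
    proof (cases "x \<in> cball 0 2")
      case True
      then have "norm (x - rotp t p q) \<le> 3"
        using norm_triangle_ineq4[of x "rotp t p q"] assms by simp
      then have "(norm (x - rotp t p q))\<^sup>2 \<le> 3\<^sup>2" by (intro power_mono) auto
      then have "exp (- 18 * pi) \<le> exp (2 * (- pi * (norm (x - rotp t p q))\<^sup>2))" by simp
      also have "\<dots> = (cmod (u x))\<^sup>2"
        by (simp add: u_def norm_mult norm_coherent flip: exp_double)
      finally show ?thesis using True by simp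
    qed simp
  qed
  also have "\<dots> = Re (cinner (U t (coherent_state p q)) (restrict_op (cball 0 2) (U t (coherent_state p q))))"
    unfolding Uu by (rule Re_cinner_restrict_op[symmetric, OF _ u]) simp
  finally show ?thesis .
qed

text \<open>The orbit stays on the line through \<open>\<xi>\<close>, with coordinate \<open>n cos t - |\<xi>| sin t\<close>. It passes through the origin
  at the time \<open>t0 = arctan (n / |\<xi>|)\<close>, which lies in \<open>[0, 1/2]\<close>, and has speed at most \<open>2 |\<xi>|\<close>. So it is in the unit
  ball during the interval of length \<open>1 / (2 |\<xi>|)\<close> that ends at \<open>t0\<close>, and this interval lies in the window.\<close>

lemma window_op_coherent_lower_bound:
  fixes \<xi> :: 'a and n :: nat
  assumes \<xi>: "1 \<le> norm \<xi>" and n: "real n \<le> norm \<xi> / 2"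
  shows "exp (- 18 * pi) * measure lborel (cball (0::'a) 2) / (2 * norm \<xi>)
    \<le> Re (cinner (coherent_state (real n *\<^sub>R sgn \<xi>) \<xi>)
        (window_op (1/2) (cball 0 2) (coherent_state (real n *\<^sub>R sgn \<xi>) \<xi>)))"
proof -
  let ?\<rho> = "norm \<xi>"
  define y where "y = real n / ?\<rho>"
  define t0 where "t0 = arctan y"
  have pos: "0 < ?\<rho>" using \<xi> by linarith
  have y: "0 \<le> y" "y \<le> 1/2" using pos n by (simp_all add: y_def divide_le_eq)
  have t0: "0 \<le> t0" "t0 \<le> 1/2"
    using y arctan_le_self[of y] by (auto simp: t0_def)
  have c: "1/2 \<le> cos t0"
  proof -
    have "1 + y\<^sup>2 \<le> 2\<^sup>2" using power_mono[OF y(2,1), of 2] by (simp add: power2_eq_square)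
    then have "sqrt (1 + y\<^sup>2) \<le> 2" by (rule real_le_lsqrt[rotated]) simp
    moreover have "0 < sqrt (1 + y\<^sup>2)" by (simp add: add_pos_nonneg)
    ultimately show ?thesis by (simp add: t0_def cos_arctan field_simps)
  qed
  have small: "norm (rotp t (real n *\<^sub>R sgn \<xi>) \<xi>) \<le> 1" if t: "t \<in> {t0 - 1 / (2 * ?\<rho>)..t0}" for t
  proof -
    have n': "real n = ?\<rho> * (sin t0 / cos t0)"
    proof -
      have "sin t0 / cos t0 = y" using tan_arctan[of y] unfolding t0_def tan_def .
      then show ?thesis using pos by (simp add: y_def)
    qed
    have "rotp t (real n *\<^sub>R sgn \<xi>) \<xi> = (real n * cos t - ?\<rho> * sin t) *\<^sub>R sgn \<xi>"
    proof -
      have "sin t *\<^sub>R \<xi> = (?\<rho> * sin t) *\<^sub>R sgn \<xi>" using pos by (simp add: sgn_div_norm)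
      then show ?thesis by (simp add: rotp_def scaleR_diff_left mult.commute)
    qed
    also have "real n * cos t - ?\<rho> * sin t = ?\<rho> * sin (t0 - t) / cos t0"
      unfolding n' sin_diff using c by (simp add: field_simps)
    finally have "norm (rotp t (real n *\<^sub>R sgn \<xi>) \<xi>) = ?\<rho> * \<bar>sin (t0 - t)\<bar> / cos t0"
      using \<xi> c by (auto simp: norm_sgn abs_mult abs_divide)
    also have "\<dots> \<le> ?\<rho> * (1 / (2 * ?\<rho>)) / (1/2)"
    proof (intro frac_le mult_left_mono)
      have "\<bar>sin (t0 - t)\<bar> \<le> \<bar>t0 - t\<bar>" by (rule abs_sin_x_le_abs_x)
      then show "\<bar>sin (t0 - t)\<bar> \<le> 1 / (2 * ?\<rho>)" using t by auto
    qed (use c \<xi> in auto)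
    also have "\<dots> = 1" using \<xi> by auto
    finally show ?thesis .
  qed
  have "1 / (2 * ?\<rho>) \<le> 1/2" using \<xi> pos by (simp add: divide_le_eq)
  moreover have "0 \<le> 1 / (2 * ?\<rho>)" using \<xi> by simp
  ultimately have "exp (- 18 * pi) * measure lborel (cball (0::'a) 2) * (t0 - (t0 - 1 / (2 * ?\<rho>)))
      \<le> Re (cinner (coherent_state (real n *\<^sub>R sgn \<xi>) \<xi>)
        (window_op (1/2) (cball 0 2) (coherent_state (real n *\<^sub>R sgn \<xi>) \<xi>)))"
    using t0 small by (intro window_op_lower_bound coherent_mass_in_ball) auto
  then show ?thesis by simp
qed

end

lemma sum_power_inj_le:
  fixes r :: real
  assumes "0 \<le> r" "r < 1" "finite A" "inj_on g A"
  shows "(\<Sum>n\<in>A. r ^ g n) \<le> 1 / (1 - r)"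
proof -
  have "(\<Sum>n\<in>A. r ^ g n) = (\<Sum>j\<in>g ` A. r ^ j)"
    using assms(4) by (simp add: sum.reindex)
  also have "\<dots> \<le> (\<Sum>j. r ^ j)"
    using assms by (intro sum_le_suminf summable_geometric) auto
  also have "\<dots> = 1 / (1 - r)" using assms by (intro suminf_geometric) auto
  finally show ?thesis .
qed

text \<open>In \<open>sum_gaussian_line_le\<close> each side of \<open>a\<close> contributes at most \<open>exp (\<pi>/4)\<close> times the sum of the geometric
  series of ratio \<open>exp (- \<pi>/2)\<close>.\<close>

definition line_bound :: real where
  "line_bound = 2 * exp (pi / 4) / (1 - exp (- pi / 2))"

lemma line_bound_nonneg: "0 \<le> line_bound"
  by (simp add: line_bound_def)

lemma sum_gaussian_line_le:
  fixes a :: real and A :: "nat set"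
  assumes "finite A"
  shows "(\<Sum>n\<in>A. exp (- pi / 4 * (real n - a)\<^sup>2)) \<le> line_bound"
proof -
  define r where "r = exp (- pi / 2)"
  have r: "0 \<le> r" "r < 1" by (auto simp: r_def)
  have pointwise: "exp (- pi / 4 * (real n - a)\<^sup>2) \<le> exp (pi / 4) * r ^ k" if "real k \<le> \<bar>real n - a\<bar>" for n k
  proof -
    \<comment> \<open>\<open>2 s - 1 \<le> s\<^sup>2\<close> replaces the Gaussian by a geometric sequence.\<close>
    have "2 * real k - 1 \<le> 2 * \<bar>real n - a\<bar> - 1" using that by simp
    also have "\<dots> \<le> (real n - a)\<^sup>2"
      using zero_le_power2[of "\<bar>real n - a\<bar> - 1"] by (simp add: power2_diff)
    finally have "pi / 4 * (2 * real k - 1) \<le> pi / 4 * (real n - a)\<^sup>2" by (intro mult_left_mono) auto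
    then have "exp (- pi / 4 * (real n - a)\<^sup>2) \<le> exp (pi / 4 + real k * (- pi / 2))"
      by (simp add: algebra_simps)
    also have "\<dots> = exp (pi / 4) * r ^ k"
      by (simp only: exp_add r_def exp_of_nat_mult)
    finally show ?thesis .
  qed
  define A1 A2 where "A1 = {n\<in>A. a \<le> real n}" and "A2 = {n\<in>A. real n < a}"
  have A: "A = A1 \<union> A2" "A1 \<inter> A2 = {}" "finite A1" "finite A2"
    using assms by (auto simp: A1_def A2_def)
  have "(\<Sum>n\<in>A1. exp (- pi / 4 * (real n - a)\<^sup>2)) \<le> (\<Sum>n\<in>A1. exp (pi / 4) * r ^ (n - nat \<lceil>a\<rceil>))"
    by (intro sum_mono pointwise) (auto simp: A1_def, linarith)
  also have "\<dots> \<le> exp (pi / 4) * (1 / (1 - r))"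
    unfolding sum_distrib_left[symmetric]
    by (intro mult_left_mono sum_power_inj_le r A) (auto simp: A1_def inj_on_def, linarith)
  finally have 1: "(\<Sum>n\<in>A1. exp (- pi / 4 * (real n - a)\<^sup>2)) \<le> exp (pi / 4) * (1 / (1 - r))" .
  have "(\<Sum>n\<in>A2. exp (- pi / 4 * (real n - a)\<^sup>2)) \<le> (\<Sum>n\<in>A2. exp (pi / 4) * r ^ (nat \<lfloor>a\<rfloor> - n))"
    by (intro sum_mono pointwise) (auto simp: A2_def, linarith)
  also have "\<dots> \<le> exp (pi / 4) * (1 / (1 - r))"
    unfolding sum_distrib_left[symmetric]
    by (intro mult_left_mono sum_power_inj_le r A) (auto simp: A2_def inj_on_def, linarith)
  finally have 2: "(\<Sum>n\<in>A2. exp (- pi / 4 * (real n - a)\<^sup>2)) \<le> exp (pi / 4) * (1 / (1 - r))" .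
  show ?thesis
    using 1 2 A by (simp add: sum.union_disjoint line_bound_def r_def)
qed

definition lattice_point :: "('a::euclidean_space \<Rightarrow> nat) \<Rightarrow> 'a" where
  "lattice_point m = (\<Sum>b\<in>Basis. real (m b) *\<^sub>R b)"

text \<open>An orbit whose position is parallel to its momentum passes through the origin. The unit spacing of the
  positions for one momentum keeps the overlaps summable.\<close>

definition lattice_state :: "('a::euclidean_space \<Rightarrow> nat) \<times> nat \<Rightarrow> 'a L2" where
  "lattice_state j = coherent_state (real (snd j) *\<^sub>R sgn (lattice_point (fst j))) (lattice_point (fst j))"

lemma inner_lattice_point: "b \<in> Basis \<Longrightarrow> lattice_point m \<bullet> b = real (m b)"
  unfolding lattice_point_def by (rule inner_sum_left_Basis)

lemma norm_lattice_point_diff: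
  "(norm (lattice_point m - lattice_point m'))\<^sup>2 = (\<Sum>b\<in>Basis. (real (m b) - real (m' b))\<^sup>2)"
  unfolding power2_norm_eq_inner
  by (subst euclidean_inner) (simp add: inner_diff_left inner_lattice_point power2_eq_square)

context hermite_group
begin

text \<open>Schur test. For a fixed momentum the positions lie on a line at unit distances, and their Gaussian weights
  sum to at most \<open>line_bound\<close>. The sum over the momenta is a product of \<open>d\<close> sums of the same kind.\<close>

lemma lattice_state_bessel:
  assumes F: "F \<subseteq> (Basis \<rightarrow>\<^sub>E {..<L}) \<times> {..<L}" and nz: "\<And>j. j \<in> F \<Longrightarrow> lattice_point (fst j) \<noteq> (0::'a)"
  shows "bessel_family (gauss_mass TYPE('a) * line_bound ^ Suc DIM('a)) lattice_state F"
proof (rule bessel_family_Schur_test)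
  have fin: "finite ((Basis::'a set) \<rightarrow>\<^sub>E {..<L})" by (intro finite_PiE) auto
  then show "finite F" by (intro finite_subset[OF F] finite_cartesian_product) auto
  show "0 \<le> gauss_mass TYPE('a) * line_bound ^ Suc DIM('a)"
    by (intro mult_nonneg_nonneg zero_le_power gauss_mass_nonneg line_bound_nonneg)
  fix j assume "j \<in> F"
  obtain m n where j: "j = (m, n)" by (cases j)
  define p where "p = real n *\<^sub>R sgn (lattice_point m)"
  define h where "h k = gauss_mass TYPE('a) * (exp (- pi / 4 * (real (snd k) - p \<bullet> sgn (lattice_point (fst k)))\<^sup>2)
      * (\<Prod>b\<in>(Basis::'a set). exp (- pi / 4 * (real (fst k b) - real (m b))\<^sup>2)))" for k
  have h0: "0 \<le> h k" for k
    unfolding h_def by (intro mult_nonneg_nonneg gauss_mass_nonneg prod_nonneg) auto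
  have le: "cmod (cinner (lattice_state j) (lattice_state k)) \<le> h k" if "k \<in> F" for k
  proof -
    obtain m' n' where k: "k = (m', n')" by (cases k)
    define u where "u = sgn (lattice_point m')"
    have u: "norm u = 1" using nz[OF that] by (simp add: k u_def norm_sgn)
    \<comment> \<open>Projecting to the line of positions can only decrease distances.\<close>
    have "\<bar>real n' - p \<bullet> u\<bar> = \<bar>(p - real n' *\<^sub>R u) \<bullet> u\<bar>"
      using u by (simp add: inner_diff_left norm_eq_1 abs_minus_commute)
    also have "\<dots> \<le> norm (p - real n' *\<^sub>R u)"
      using Cauchy_Schwarz_ineq2[of "p - real n' *\<^sub>R u" u] u by simp
    finally have sq: "(real n' - p \<bullet> u)\<^sup>2 \<le> (norm (p - real n' *\<^sub>R u))\<^sup>2"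
      by (metis abs_ge_zero power2_abs power_mono)
    have "cmod (cinner (lattice_state j) (lattice_state k))
        \<le> gauss_mass TYPE('a) * (exp (- pi / 4 * (norm (p - real n' *\<^sub>R u))\<^sup>2)
          * exp (- pi / 4 * (norm (lattice_point m - lattice_point m'))\<^sup>2))"
      using coherent_overlap[of p "lattice_point m" "real n' *\<^sub>R u" "lattice_point m'"]
      by (simp add: lattice_state_def j k p_def u_def)
    also have "\<dots> \<le> gauss_mass TYPE('a) * (exp (- pi / 4 * (real n' - p \<bullet> u)\<^sup>2)
          * exp (- pi / 4 * (norm (lattice_point m - lattice_point m'))\<^sup>2))"
      using sq by (intro mult_left_mono mult_right_mono gauss_mass_nonneg) auto
    also have "exp (- pi / 4 * (norm (lattice_point m - lattice_point m'))\<^sup>2)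
        = (\<Prod>b\<in>(Basis::'a set). exp (- pi / 4 * (real (m' b) - real (m b))\<^sup>2))"
      unfolding norm_lattice_point_diff sum_distrib_left exp_sum[OF finite_Basis]
      by (simp add: power2_commute)
    finally show ?thesis by (simp add: h_def k u_def)
  qed
  have "(\<Sum>k\<in>F. cmod (cinner (lattice_state j) (lattice_state k))) \<le> (\<Sum>k\<in>F. h k)"
    by (intro sum_mono le)
  also have "\<dots> \<le> (\<Sum>k\<in>(Basis \<rightarrow>\<^sub>E {..<L}) \<times> {..<L}. h k)"
    using F h0 fin by (intro sum_mono2) auto
  also have "\<dots> = (\<Sum>m'\<in>Basis \<rightarrow>\<^sub>E {..<L}. \<Sum>n'<L. h (m', n'))"
    by (simp add: sum.cartesian_product)
  also have "\<dots> = (\<Sum>m'\<in>Basis \<rightarrow>\<^sub>E {..<L}. gauss_mass TYPE('a) * ((\<Sum>n'<L. exp (- pi / 4 * (real n' - p \<bullet> sgn (lattice_point m'))\<^sup>2))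
      * (\<Prod>b\<in>(Basis::'a set). exp (- pi / 4 * (real (m' b) - real (m b))\<^sup>2))))"
    by (simp add: h_def sum_distrib_left sum_distrib_right)
  also have "\<dots> \<le> (\<Sum>m'\<in>Basis \<rightarrow>\<^sub>E {..<L}. gauss_mass TYPE('a) * (line_bound
      * (\<Prod>b\<in>(Basis::'a set). exp (- pi / 4 * (real (m' b) - real (m b))\<^sup>2))))"
    by (intro sum_mono mult_left_mono mult_right_mono gauss_mass_nonneg sum_gaussian_line_le prod_nonneg) auto
  also have "\<dots> = gauss_mass TYPE('a) * line_bound * (\<Sum>m'\<in>Basis \<rightarrow>\<^sub>E {..<L}. \<Prod>b\<in>(Basis::'a set). exp (- pi / 4 * (real (m' b) - real (m b))\<^sup>2))"
    by (simp add: sum_distrib_left mult.assoc)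
  also have "(\<Sum>m'\<in>Basis \<rightarrow>\<^sub>E {..<L}. \<Prod>b\<in>(Basis::'a set). exp (- pi / 4 * (real (m' b) - real (m b))\<^sup>2))
      = (\<Prod>b\<in>(Basis::'a set). \<Sum>l<L. exp (- pi / 4 * (real l - real (m b))\<^sup>2))"
    by (rule prod_sum_PiE[symmetric]) auto
  also have "gauss_mass TYPE('a) * line_bound * \<dots> \<le> gauss_mass TYPE('a) * line_bound * (\<Prod>b\<in>(Basis::'a set). line_bound)"
    by (intro mult_left_mono prod_mono conjI sum_gaussian_line_le sum_nonneg mult_nonneg_nonneg gauss_mass_nonneg line_bound_nonneg) auto
  also have "\<dots> = gauss_mass TYPE('a) * line_bound ^ Suc DIM('a)" by simp
  finally show "(\<Sum>k\<in>F. cmod (cinner (lattice_state j) (lattice_state k))) \<le> gauss_mass TYPE('a) * line_bound ^ Suc DIM('a)" .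
qed

text \<open>All coordinates of the momentum lie between \<open>2 ^ k\<close> and \<open>2 ^ (k + 1)\<close>. The same range
  of positions, up to half of \<open>2 ^ k\<close>, is admissible for all of these momenta.\<close>

definition dyadic_block :: "nat \<Rightarrow> (('a \<Rightarrow> nat) \<times> nat) set" where
  "dyadic_block k = (Basis \<rightarrow>\<^sub>E {2 ^ k..<2 ^ Suc k}) \<times> {..2 ^ k div 2}"

lemma finite_dyadic_block: "finite (dyadic_block k)"
  unfolding dyadic_block_def by (intro finite_cartesian_product finite_PiE) auto

lemma card_dyadic_block: "card (dyadic_block k) = (2 ^ k) ^ DIM('a) * Suc (2 ^ k div 2)"
  unfolding dyadic_block_def by (simp add: card_cartesian_product card_PiE)

lemma dyadic_block_norm:
  assumes "(m, n) \<in> dyadic_block k"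
  shows "2 ^ k \<le> norm (lattice_point m :: 'a)" "norm (lattice_point m :: 'a) \<le> real DIM('a) * (2 * 2 ^ k)"
    "real n \<le> 2 ^ k / 2"
proof -
  have m: "2 ^ k \<le> m b" "m b < 2 ^ Suc k" if "b \<in> Basis" for b :: 'a
    using assms that by (auto simp: dyadic_block_def PiE_iff)
  obtain b :: 'a where b: "b \<in> Basis" using nonempty_Basis by blast
  have "2 ^ k \<le> real (m b)" using m(1)[OF b] by (simp flip: of_nat_le_iff)
  also have "\<dots> \<le> norm (lattice_point m)"
    using Basis_le_norm[OF b, of "lattice_point m"] by (simp add: inner_lattice_point b)
  finally show "2 ^ k \<le> norm (lattice_point m :: 'a)" .
  have "norm (lattice_point m :: 'a) \<le> (\<Sum>b\<in>(Basis::'a set). real (m b))"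
    unfolding lattice_point_def by (intro order_trans[OF norm_sum] sum_mono) simp
  also have "\<dots> \<le> (\<Sum>b\<in>(Basis::'a set). 2 * 2 ^ k)"
  proof (rule sum_mono)
    fix b :: 'a assume "b \<in> Basis"
    then have "real (m b) < real (2 ^ Suc k)" using m(2) by (simp only: of_nat_less_iff)
    then show "real (m b) \<le> 2 * 2 ^ k" by simp
  qed
  finally show "norm (lattice_point m :: 'a) \<le> real DIM('a) * (2 * 2 ^ k)" by simp
  have "n \<le> 2 ^ k div 2" using assms by (auto simp: dyadic_block_def)
  then have "2 * n \<le> 2 ^ k" by simp
  then have "real (2 * n) \<le> real (2 ^ k)" by (simp only: of_nat_le_iff)
  then show "real n \<le> 2 ^ k / 2" by simp
qed

lemma dyadic_block_disjoint:
  assumes "k \<noteq> k'"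
  shows "dyadic_block k \<inter> dyadic_block k' = {}"
proof -
  have False if "k < k'" "(m, n) \<in> dyadic_block k" "(m, n) \<in> dyadic_block k'" for k k' m n
  proof -
    obtain b :: 'a where b: "b \<in> Basis" using nonempty_Basis by blast
    have "m b < 2 ^ Suc k" "2 ^ k' \<le> m b"
      using that b by (auto simp: dyadic_block_def PiE_iff)
    moreover have "(2::nat) ^ Suc k \<le> 2 ^ k'" using that(1) by (intro power_increasing) auto
    ultimately show False by linarith
  qed
  then show ?thesis using assms by (metis disjoint_iff linorder_neqE_nat surj_pair)
qed

abbreviation witness_op :: "'a L2 \<Rightarrow> 'a L2" where
  "witness_op \<equiv> window_op (1/2) (cball 0 2)"

text \<open>A block has at least \<open>2 ^ (k (d + 1)) / 2\<close> elements, and each of them contributes at least a constant times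
  \<open>2 ^ (- k (d + 1))\<close>. The exponent \<open>d + 1\<close> is the one for which the powers of \<open>2 ^ k\<close> cancel.\<close>

lemma dyadic_block_sum:
  defines "\<kappa> \<equiv> (exp (- 18 * pi) * measure lborel (cball (0::'a) 2) / (4 * real DIM('a))) ^ Suc DIM('a) / 2"
  shows "\<kappa> \<le> gauss_mass TYPE('a) ^ DIM('a) *
    (\<Sum>j\<in>dyadic_block k. Re (cinner (lattice_state j) ((witness_op ^^ Suc DIM('a)) (lattice_state j))))"
proof -
  define c0 where "c0 = exp (- 18 * pi) * measure lborel (cball (0::'a) 2)"
  define d where "d = DIM('a)"
  have d: "0 < d" by (simp add: d_def)
  have c0: "0 \<le> c0" by (simp add: c0_def)
  have state: "(c0 / (4 * real d * 2 ^ k)) ^ Suc d \<le> gauss_mass TYPE('a) ^ d *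
      Re (cinner (lattice_state j) ((witness_op ^^ Suc d) (lattice_state j)))" if "j \<in> dyadic_block k" for j
  proof -
    obtain m n where j: "j = (m, n)" by (cases j)
    define \<xi> where "\<xi> = (lattice_point m :: 'a)"
    note norms = dyadic_block_norm[OF that[unfolded j], folded \<xi>_def d_def]
    have "(1::real) \<le> 2 ^ k" by simp
    then have \<xi>: "1 \<le> norm \<xi>" "real n \<le> norm \<xi> / 2" using norms by linarith+
    have "c0 / (4 * real d * 2 ^ k) \<le> c0 / (2 * norm \<xi>)"
      using norms(2) \<xi>(1) c0 by (intro divide_left_mono) (auto intro!: mult_pos_pos d simp: mult_ac)
    also have "\<dots> \<le> Re (cinner (lattice_state j) (witness_op (lattice_state j)))"
      using window_op_coherent_lower_bound[OF \<xi>] by (simp add: c0_def lattice_state_def j \<xi>_def)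
    finally have "(c0 / (4 * real d * 2 ^ k)) ^ Suc d \<le> Re (cinner (lattice_state j) (witness_op (lattice_state j))) ^ Suc d"
      using c0 by (intro power_mono) auto
    also have "\<dots> \<le> ((norm (lattice_state j))\<^sup>2) ^ d * Re (cinner (lattice_state j) ((witness_op ^^ Suc d) (lattice_state j)))"
      by (intro moment_inequality positive_form_window_op) auto
    also have "(norm (lattice_state j))\<^sup>2 = gauss_mass TYPE('a)"
      unfolding lattice_state_def norm_coherent_state_sq gauss_mass_def ..
    finally show ?thesis .
  qed
  have "(c0 / (4 * real d)) ^ Suc d / 2 = (2 ^ k) ^ d * (2 ^ k / 2) * (c0 / (4 * real d * 2 ^ k)) ^ Suc d"
    by (simp add: power_divide power_mult_distrib)
  also have "\<dots> \<le> real (card (dyadic_block k)) * (c0 / (4 * real d * 2 ^ k)) ^ Suc d"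
  proof (rule mult_right_mono)
    have "x \<le> 2 * Suc (x div 2)" for x :: nat by presburger
    then have "(2::nat) ^ k \<le> 2 * Suc (2 ^ k div 2)" .
    then have "real (2 ^ k) \<le> real (2 * Suc (2 ^ k div 2))" by (simp only: of_nat_le_iff)
    then have "2 ^ k / 2 \<le> real (Suc (2 ^ k div 2))" by simp
    then show "(2 ^ k) ^ d * (2 ^ k / 2) \<le> real (card (dyadic_block k))"
      unfolding card_dyadic_block d_def[symmetric] of_nat_mult by (intro mult_mono) auto
    show "0 \<le> (c0 / (4 * real d * 2 ^ k)) ^ Suc d" using c0 by (intro zero_le_power divide_nonneg_nonneg) auto
  qed
  also have "\<dots> = (\<Sum>j\<in>dyadic_block k. (c0 / (4 * real d * 2 ^ k)) ^ Suc d)" by simp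
  also have "\<dots> \<le> (\<Sum>j\<in>dyadic_block k. gauss_mass TYPE('a) ^ d *
      Re (cinner (lattice_state j) ((witness_op ^^ Suc d) (lattice_state j))))"
    by (intro sum_mono state)
  finally show ?thesis
    unfolding \<kappa>_def c0_def[symmetric] d_def[symmetric] sum_distrib_left[symmetric] .
qed

lemma has_trace_witness_op: "has_trace (witness_op ^^ Suc DIM('a)) \<infinity>"
proof (rule has_trace_infinite)
  let ?A = "witness_op" and ?d = "DIM('a)"
  have lin: "bounded_linear ?A" by (rule bounded_linear_window_op) auto
  have "bounded_linear (?A ^^ n)" for n
    by (induction n) (auto simp: id_def o_def bounded_linear_ident intro: bounded_linear_compose[OF lin])
  then show "bounded_linear (?A ^^ Suc ?d)" .
  show "positive_form (\<lambda>f g. cinner f ((?A ^^ Suc ?d) g))"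
    by (intro positive_form_power positive_form_window_op) auto
  show "0 \<le> gauss_mass TYPE('a) * line_bound ^ Suc ?d"
    by (intro mult_nonneg_nonneg zero_le_power gauss_mass_nonneg line_bound_nonneg)
  fix K :: real
  define \<kappa> where "\<kappa> = (exp (- 18 * pi) * measure lborel (cball (0::'a) 2) / (4 * real ?d)) ^ Suc ?d / 2"
  have "0 < measure lborel (cball (0::'a) 2)"
    using content_cball_pos[of 2 "0::'a"] by simp
  then have \<kappa>: "0 < \<kappa>" by (simp add: \<kappa>_def)
  let ?q = "\<lambda>j. Re (cinner (lattice_state j) ((?A ^^ Suc ?d) (lattice_state j)))"
  obtain N where N: "gauss_mass TYPE('a) ^ ?d * K < real N * \<kappa>"
    using reals_Archimedean3[OF \<kappa>] by blast
  define F where "F = (\<Union>k<N. dyadic_block k)"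
  have "F \<subseteq> (Basis \<rightarrow>\<^sub>E {..<2 ^ N}) \<times> {..<2 ^ N}"
  proof
    fix j assume "j \<in> F"
    then obtain k m n where j: "j = (m, n)" "k < N" "(m, n) \<in> dyadic_block k" by (cases j) (auto simp: F_def)
    have le: "(2::nat) ^ Suc k \<le> 2 ^ N" using j(2) by (intro power_increasing) auto
    have "n \<le> 2 ^ k div 2" and m: "m \<in> Basis \<rightarrow>\<^sub>E {2 ^ k..<2 ^ Suc k}" using j(3) by (auto simp: dyadic_block_def)
    moreover have "(2::nat) ^ k div 2 < 2 ^ Suc k" by (rule le_less_trans[OF div_le_dividend]) simp
    ultimately have "n < 2 ^ N" using le by linarith
    moreover have "m \<in> Basis \<rightarrow>\<^sub>E {..<2 ^ N}"
    proof -
      have "{2 ^ k..<2 ^ Suc k} \<subseteq> {..<(2::nat) ^ N}" using le less_le_trans by (fastforce simp del: power_Suc power_increasing_iff)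
      then show ?thesis using m PiE_mono[of "Basis :: 'a set" "\<lambda>_. {2 ^ k..<2 ^ Suc k}" "\<lambda>_. {..<2 ^ N}"] by blast
    qed
    ultimately show "j \<in> (Basis \<rightarrow>\<^sub>E {..<2 ^ N}) \<times> {..<2 ^ N}" by (simp add: j)
  qed
  moreover have "lattice_point (fst j) \<noteq> (0::'a)" if jF: "j \<in> F" for j
  proof
    assume 0: "lattice_point (fst j) = (0::'a)"
    obtain k where "(fst j, snd j) \<in> dyadic_block k" using jF unfolding F_def prod.collapse by blast
    from dyadic_block_norm(1)[OF this] have "(2::real) ^ k \<le> 0" by (simp add: 0)
    moreover have "(0::real) < 2 ^ k" by simp
    ultimately show False by linarith
  qed
  ultimately have "bessel_family (gauss_mass TYPE('a) * line_bound ^ Suc ?d) lattice_state F"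
    by (rule lattice_state_bessel)
  moreover have "finite F" unfolding F_def by (intro finite_UN_I finite_dyadic_block) auto
  moreover have "K < (\<Sum>j\<in>F. ?q j)"
  proof -
    have "gauss_mass TYPE('a) ^ ?d * K < (\<Sum>k<N. \<kappa>)" using N by simp
    also have "\<dots> \<le> (\<Sum>k<N. gauss_mass TYPE('a) ^ ?d * (\<Sum>j\<in>dyadic_block k. ?q j))"
      unfolding \<kappa>_def by (intro sum_mono dyadic_block_sum)
    also have "\<dots> = gauss_mass TYPE('a) ^ ?d * (\<Sum>j\<in>F. ?q j)"
      unfolding F_def sum_distrib_left[symmetric]
      by (subst sum.UNION_disjoint) (auto simp: finite_dyadic_block dyadic_block_disjoint)
    finally show ?thesis
      by (rule mult_left_less_imp_less) (simp add: gauss_mass_nonneg)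
  qed
  ultimately show "\<exists>F. finite F \<and> bessel_family (gauss_mass TYPE('a) * line_bound ^ Suc ?d) lattice_state F \<and> K < (\<Sum>j\<in>F. ?q j)"
    by blast
qed

end

theorem proposition5p4:
  fixes U :: "real \<Rightarrow> 'a::euclidean_space L2 \<Rightarrow> 'a L2"
  assumes "unitary_group_generated_by hermite_op U"
  shows "\<exists>V \<in> Linf_c ({-pi/4 <..< pi/4} \<times> (UNIV :: 'a set)). \<exists>A :: 'a L2 \<Rightarrow> 'a L2.
           has_op_integral (\<lambda>t. U (-t) \<circ> mult_op (\<lambda>x. V (t, x)) \<circ> U t) A {-pi/4 <..< pi/4} \<and>
           has_trace (A ^^ (DIM('a) + 1)) \<infinity>"
proof -
  interpret hermite_group U by standard (rule assms)
  let ?K = "{-1/2..1/2::real} \<times> cball (0::'a) 2"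
  have window: "{-1/2..1/2} \<subseteq> {-pi/4 <..< pi/4}" using pi_gt3 by auto
  have "compact ?K" by (intro compact_Times compact_Icc compact_cball)
  then have "?K \<in> sets borel" by (rule borel_compact)
  then have "(indicator ?K :: real \<times> 'a \<Rightarrow> complex) \<in> Linf_c ({-pi/4 <..< pi/4} \<times> UNIV)"
    unfolding Linf_c_def using \<open>compact ?K\<close> window
    by (auto intro!: exI[of _ ?K] boundedI[of _ 1] simp: indicator_def)
  moreover have "has_op_integral (\<lambda>t. U (-t) \<circ> mult_op (\<lambda>x. indicator ?K (t, x)) \<circ> U t)
      (window_op (1/2) (cball 0 2)) {-pi/4 <..< pi/4}"
    using has_op_integral_window_op[of "cball 0 2" "1/2" "{-pi/4 <..< pi/4}"] window by simp
  moreover have "has_trace (window_op (1/2) (cball 0 2) ^^ (DIM('a) + 1)) \<infinity>"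
    using has_trace_witness_op by simp
  ultimately show ?thesis by blast
qed

end
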